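(* For all $l,m\in\mathbb{Z}_{\ge0}$, the $\mathcal{U}(\epsilon)$-module $\mathcal{W}_{l,\epsilon}\otimes\mathcal{W}_{m,\epsilon}$ is irreducible, where $\mathcal{W}_{s,\epsilon}=\mathcal{W}_{s,\epsilon}(1)$.
   Context: Fix an integer $n\ge 4$ and $\epsilon=(\epsilon_1,\dots,\epsilon_n)\in\{0,1\}^n$. Put $\mathbb{I}=\{1,\dots,n\}$, $I=\{0,1,\dots,n-1\}$; indices in $I$ are read modulo $n$, and the index $0$ is identified with $n$ when regarded as an element of $\mathbb{I}$. Let $P=\bigoplus_{i\in\mathbb{I}}\mathbb{Z}\delta_i$, $\alpha_i=\delta_i-\delta_{i+1}$ ($i\in I$; so $\alpha_0=\delta_n-\delta_1$), and let $\langle\alpha_i,\delta_j^\vee\rangle$ denote the coefficient of $\delta_j$ in $\alpha_i$. Let $I_{\rm even}=\{i\in I:\epsilon_i=\epsilon_{i+1}\}$, $I_{\rm odd}=I\setminus I_{\rm even}$. Let $q$ be an indeterminate, $[k]=(q^k-q^{-k})/(q-q^{-1})$, $[2]=q+q^{-1}$, and $q_j=q$ if $\epsilon_j=0$, $q_j=-q^{-1}$ if $\epsilon_j=1$. The generalized quantum group $\mathcal{U}(\epsilon)$ is the $\mathbb{Q}(q)$-algebra generated by pairwise commuting invertible elements $\omega_j$ ($j\in\mathbb{I}$) and $e_i,f_i$ ($i\in I$) with relations: $\omega_je_i\omega_j^{-1}=q_j^{\langle\alpha_i,\delta_j^\vee\rangle}e_i$, $\omega_jf_i\omega_j^{-1}=q_j^{-\langle\alpha_i,\delta_j^\vee\rangle}f_i$;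 $e_if_j-f_je_i=\delta_{ij}(k_i-k_i^{-1})/(q-q^{-1})$ where $k_i=\omega_i\omega_{i+1}^{-1}$; $e_i^2=f_i^2=0$ for $i\in I_{\rm odd}$; $e_ie_j=e_je_i$, $f_if_j=f_jf_i$ if $i\ne j$ are not cyclically adjacent; $e_i^2e_j-(-1)^{\epsilon_i}[2]e_ie_je_i+e_je_i^2=0$ and likewise for $f$ if $i\in I_{\rm even}$, $j=i\pm1$; and for $i\in I_{\rm odd}$: $e_ie_{i-1}e_ie_{i+1}-e_ie_{i+1}e_ie_{i-1}+e_{i+1}e_ie_{i-1}e_i-e_{i-1}e_ie_{i+1}e_i+(-1)^{\epsilon_i}[2]e_ie_{i-1}e_{i+1}e_i=0$ and the same with $f$. Tensor products of modules use the comultiplication $\Delta(\omega_j)=\omega_j\otimes\omega_j$, $\Delta(e_i)=e_i\otimes1+k_i^{-1}\otimes e_i$, $\Delta(f_i)=f_i\otimes k_i+1\otimes f_i$. Let $\mathbb{Z}^n_+(\epsilon)$ be the set of $\mathbf{m}=(m_1,\dots,m_n)$ with $m_i\in\mathbb{Z}_{\ge0}$ if $\epsilon_i=0$ and $m_i\in\{0,1\}$ if $\epsilon_i=1$; $|\mathbf m|=\sum m_i$; $\mathbf{e}_i$ is the $i$-th unit vector ($\mathbf e_0=\mathbf e_n$). For $s\in\mathbb{Z}_{\ge0}$ and $x\in\mathbb{Q}(q)^\times$, $\mathcal{W}_{s,\epsilon}(x)$ is the $\mathcal{U}(\epsilon)$-module with basis $\{|\mathbf m\rangle:\mathbf m\in\mathbb{Z}^n_+(\epsilon),|\mathbf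 m|=s\}$ and $e_i|\mathbf m\rangle=x^{\delta_{i0}}q^{m_{i+1}-m_i-1}[m_{i+1}]|\mathbf m+\mathbf e_i-\mathbf e_{i+1}\rangle$ if $\mathbf m+\mathbf e_i-\mathbf e_{i+1}\in\mathbb{Z}^n_+(\epsilon)$ and $0$ otherwise; $f_i|\mathbf m\rangle=x^{-\delta_{i0}}q^{m_i-m_{i+1}-1}[m_i]|\mathbf m-\mathbf e_i+\mathbf e_{i+1}\rangle$ if $\mathbf m-\mathbf e_i+\mathbf e_{i+1}\in\mathbb{Z}^n_+(\epsilon)$ and $0$ otherwise; $\omega_j|\mathbf m\rangle=q_j^{m_j}|\mathbf m\rangle$.
   Formalization: The formal theorem assumes that W_{l,ε} and W_{m,ε} are nonzero; this excludes only ε=(1,…,1) with l>n or m>n, where the tensor product is the zero module and so is not irreducible. *)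

theory Defs
  imports "HOL-Computational_Algebra.Fraction_Field" "HOL-Computational_Algebra.Polynomial"
begin

type_synonym K = "rat poly fract"

definition qq :: K where "qq = Fraction_Field.Fract [:0, 1:] 1"

definition qint :: "int \<Rightarrow> K" where
  "qint k = (qq powi k - qq powi (-k)) / (qq - inverse qq)"

text \<open>Indices: epsilon and tuples are functions on nat, meaningful on {1..n}.
  An index i (read modulo n) is sent to its representative in {1..n}
  (0 is identified with n).\<close>
definition ix :: "nat \<Rightarrow> nat \<Rightarrow> nat" where
  "ix n i = (if i mod n = 0 then n else i mod n)"

definition qj :: "(nat \<Rightarrow> nat) \<Rightarrow> nat \<Rightarrow> K" where
  "qj eps j = (if eps j = 0 then qq else - inverse qq)"

definition Zplus :: "nat \<Rightarrow> (nat \<Rightarrow> nat) \<Rightarrow> (nat \<Rightarrow> nat) set" where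
  "Zplus n eps = {m. (\<forall>i. i \<notin> {1..n} \<longrightarrow> m i = 0) \<and> (\<forall>i\<in>{1..n}. eps i = 1 \<longrightarrow> m i \<le> 1)}"

definition Wbasis :: "nat \<Rightarrow> (nat \<Rightarrow> nat) \<Rightarrow> nat \<Rightarrow> (nat \<Rightarrow> nat) set" where
  "Wbasis n eps s = {m \<in> Zplus n eps. (\<Sum>i\<in>{1..n}. m i) = s}"

text \<open>m + e_a - e_b (for a \<noteq> b, defined only when m_b \<ge> 1).\<close>
definition shift :: "(nat \<Rightarrow> nat) \<Rightarrow> nat \<Rightarrow> nat \<Rightarrow> (nat \<Rightarrow> nat)" where
  "shift m a b = m(a := m a + 1, b := m b - 1)"

text \<open>Matrix coefficient <p| e_i |r> in W_{s,eps}(x), for i in I = {0..n-1}.\<close>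
definition Ecoef :: "nat \<Rightarrow> (nat \<Rightarrow> nat) \<Rightarrow> K \<Rightarrow> nat \<Rightarrow> (nat \<Rightarrow> nat) \<Rightarrow> (nat \<Rightarrow> nat) \<Rightarrow> K" where
  "Ecoef n eps x i p r =
     (let a = ix n i; b = ix n (i + 1) in
      if 1 \<le> r b \<and> shift r a b \<in> Zplus n eps \<and> p = shift r a b
      then (if i = 0 then x else 1) * qq powi (int (r b) - int (r a) - 1) * qint (int (r b))
      else 0)"

definition Fcoef :: "nat \<Rightarrow> (nat \<Rightarrow> nat) \<Rightarrow> K \<Rightarrow> nat \<Rightarrow> (nat \<Rightarrow> nat) \<Rightarrow> (nat \<Rightarrow> nat) \<Rightarrow> K" where
  "Fcoef n eps x i p r =
     (let a = ix n i; b = ix n (i + 1) in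
      if 1 \<le> r a \<and> shift r b a \<in> Zplus n eps \<and> p = shift r b a
      then (if i = 0 then inverse x else 1) * qq powi (int (r a) - int (r b) - 1) * qint (int (r a))
      else 0)"

definition omega_ev :: "(nat \<Rightarrow> nat) \<Rightarrow> nat \<Rightarrow> (nat \<Rightarrow> nat) \<Rightarrow> K" where
  "omega_ev eps j m = qj eps j ^ m j"

definition k_ev :: "nat \<Rightarrow> (nat \<Rightarrow> nat) \<Rightarrow> nat \<Rightarrow> (nat \<Rightarrow> nat) \<Rightarrow> K" where
  "k_ev n eps i m = omega_ev eps (ix n i) m / omega_ev eps (ix n (i + 1)) m"

type_synonym idx2 = "(nat \<Rightarrow> nat) \<times> (nat \<Rightarrow> nat)"

definition TBasis :: "nat \<Rightarrow> (nat \<Rightarrow> nat) \<Rightarrow> nat \<Rightarrow> nat \<Rightarrow> idx2 set" where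
  "TBasis n eps l m = Wbasis n eps l \<times> Wbasis n eps m"

text \<open>Matrix coefficients of the generators on W_{l,eps}(x) (x) W_{m,eps}(y), via
  Delta(e_i) = e_i (x) 1 + k_i^{-1} (x) e_i, Delta(f_i) = f_i (x) k_i + 1 (x) f_i,
  Delta(omega_j) = omega_j (x) omega_j.\<close>
definition TE :: "nat \<Rightarrow> (nat \<Rightarrow> nat) \<Rightarrow> K \<Rightarrow> K \<Rightarrow> nat \<Rightarrow> idx2 \<Rightarrow> idx2 \<Rightarrow> K" where
  "TE n eps x y i p r =
     Ecoef n eps x i (fst p) (fst r) * (if snd p = snd r then 1 else 0)
     + (if fst p = fst r then inverse (k_ev n eps i (fst r)) else 0) * Ecoef n eps y i (snd p) (snd r)"

definition TF :: "nat \<Rightarrow> (nat \<Rightarrow> nat) \<Rightarrow> K \<Rightarrow> K \<Rightarrow> nat \<Rightarrow> idx2 \<Rightarrow> idx2 \<Rightarrow> K" where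
  "TF n eps x y i p r =
     Fcoef n eps x i (fst p) (fst r) * (if snd p = snd r then k_ev n eps i (snd r) else 0)
     + (if fst p = fst r then 1 else 0) * Fcoef n eps y i (snd p) (snd r)"

definition TOmega :: "(nat \<Rightarrow> nat) \<Rightarrow> nat \<Rightarrow> idx2 \<Rightarrow> idx2 \<Rightarrow> K" where
  "TOmega eps j p r = (if p = r then omega_ev eps j (fst r) * omega_ev eps j (snd r) else 0)"

definition TOmegaInv :: "(nat \<Rightarrow> nat) \<Rightarrow> nat \<Rightarrow> idx2 \<Rightarrow> idx2 \<Rightarrow> K" where
  "TOmegaInv eps j p r = (if p = r then inverse (omega_ev eps j (fst r) * omega_ev eps j (snd r)) else 0)"

definition vspace :: "idx2 set \<Rightarrow> (idx2 \<Rightarrow> K) set" where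
  "vspace B = {v. \<forall>p. p \<notin> B \<longrightarrow> v p = 0}"

definition act :: "idx2 set \<Rightarrow> (idx2 \<Rightarrow> idx2 \<Rightarrow> K) \<Rightarrow> (idx2 \<Rightarrow> K) \<Rightarrow> (idx2 \<Rightarrow> K)" where
  "act B C v = (\<lambda>p. if p \<in> B then (\<Sum>r\<in>B. C p r * v r) else 0)"

definition generators :: "nat \<Rightarrow> (nat \<Rightarrow> nat) \<Rightarrow> K \<Rightarrow> K \<Rightarrow> (idx2 \<Rightarrow> idx2 \<Rightarrow> K) set" where
  "generators n eps x y =
     (\<Union>j\<in>{1..n}. {TOmega eps j, TOmegaInv eps j})
     \<union> (\<Union>i\<in>{0..<n}. {TE n eps x y i, TF n eps x y i})"

text \<open>A U(eps)-submodule: a subspace invariant under all generators (U(eps) is generated by them).\<close>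
definition is_submodule :: "idx2 set \<Rightarrow> (idx2 \<Rightarrow> idx2 \<Rightarrow> K) set \<Rightarrow> (idx2 \<Rightarrow> K) set \<Rightarrow> bool" where
  "is_submodule B G S \<longleftrightarrow> S \<subseteq> vspace B \<and> (\<lambda>p. 0) \<in> S
     \<and> (\<forall>u\<in>S. \<forall>v\<in>S. (\<lambda>p. u p + v p) \<in> S) \<and> (\<forall>c. \<forall>v\<in>S. (\<lambda>p. c * v p) \<in> S)
     \<and> (\<forall>C\<in>G. \<forall>v\<in>S. act B C v \<in> S)"

definition irreducible_mod :: "idx2 set \<Rightarrow> (idx2 \<Rightarrow> idx2 \<Rightarrow> K) set \<Rightarrow> bool" where
  "irreducible_mod B G \<longleftrightarrow> vspace B \<noteq> {\<lambda>p. 0}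
     \<and> (\<forall>S. is_submodule B G S \<longrightarrow> S = {\<lambda>p. 0} \<or> S = vspace B)"

end

theory Submission
  imports Defs
begin

text \<open>
  A diagonal bilinear form on the tensor product makes each \<open>e\<^sub>i\<close> adjoint to a scalar multiple of
  \<open>f\<^sub>i k\<^sub>i\<^sup>-\<^sup>1\<close>, so the orthogonal complement of a submodule is again a submodule.  It therefore
  suffices to find one basis vector that lies in every nonzero submodule: its norm is nonzero, so it
  cannot lie both in a submodule and in the complement.

  Arrange the sites cyclically as \<open>u 0, \<dots>, u (n - 1)\<close>, starting at an even site if there is one,
  and take in the given submodule a weight vector whose boxes sit as far to the front as possible.
  It is killed by every operator moving a box forward: by the generators \<open>e\<close>, and also by the
  product of generators \<open>f\<close> that carries the last box around the other arc of the circle.  Each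
  condition is a two-term relation between coefficients.  Following the support along these
  relations shows that all sites strictly between two sites \<open>z < b\<close> are odd and singly occupied,
  and then the relations obtained along the two arcs from \<open>b\<close> to \<open>z\<close> contradict each other by a power
  of \<open>q\<close>.  What remains is a one-dimensional weight space, the same for all submodules.
\<close>

subsection \<open>q-integers and the diagonal form\<close>

text \<open>The two arcs can be compared because the coproduct is asymmetric: a generator
  \<open>e\<close> weights one term by the inverse of \<open>k\<close> on the first factor, a
  generator \<open>f\<close> weights one term by \<open>k\<close> on the second. Eliminating between
  the two relations multiplies these weights, so that only total occupations survive: q^(b-z-1)
  Q_b^(\<nu>_b - 1) = Q_z^(\<nu>_z + 1), with one factor q for each site between z and b. Unequal
  spectral parameters would bring in a power of their ratio. If the first site is even, it holds at
  least as many boxes as the number T found elsewhere, whereas the identity says that it holds T -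
  2; if all sites are odd, the identity reads q^(b-z-1) = q^(-2). The obstacle is the product of
  generators \<open>f\<close>: a box carried through an occupied site in general mixes with what it
  meets. Empty sites and doubly filled odd sites are harmless, so the study of the support must
  establish that pattern outside the interval from z to b, besides single occupation inside
  it.\<close>

lemma qq_gt_1: "qq > 1"
proof -
  \<comment> \<open>Polynomials are ordered by the sign of the leading coefficient, so q exceeds
    every rational. The order serves to separate powers of q and to show that q-integers do not
    vanish.\<close>
  have "pos_poly ([:-1, 1:] :: rat poly)" by (simp add: pos_poly_def)
  then have "(1 :: rat poly) < [:0, 1:]" by (simp add: less_poly_def one_pCons)
  then show ?thesis by (simp add: qq_def Fraction_Field.one_less_Fract_iff)
qed

lemma qq_pos: "qq > 0" and qq_nz [simp]: "qq \<noteq> 0"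
  using qq_gt_1 by (auto intro: less_trans[OF zero_less_one])

lemma qq_pow_inj: "qq ^ a = qq ^ b \<longleftrightarrow> a = b"
  using qq_gt_1 by (simp add: power_inject_exp)

lemma qq_powi_less: "k < k' \<Longrightarrow> qq powi k < qq powi k'"
  using qq_gt_1 by (simp add: power_int_strict_increasing)

lemma qint_0 [simp]: "qint 0 = 0"
  by (simp add: qint_def)

lemma qint_1 [simp]: "qint 1 = 1"
proof -
  have "inverse qq < qq" using qq_gt_1
    by (meson inverse_less_1_iff less_trans)
  then show ?thesis by (simp add: qint_def)
qed

lemma qint_nz: "k > 0 \<Longrightarrow> qint k \<noteq> 0"
proof -
  assume "k > 0"
  then have "qq powi (-k) < qq powi k" by (intro qq_powi_less) simp
  moreover have "inverse qq < qq" using qq_gt_1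
    by (meson inverse_less_1_iff less_trans)
  ultimately show ?thesis by (simp add: qint_def)
qed

lemma qj_nz [simp]: "qj eps j \<noteq> 0"
  by (simp add: qj_def)

text \<open>At odd sites \<open>qj\<close> is the negative element -1/q; absolute values reduce both
  parities to powers of q or of 1/q. Through this lemma the eigenvalues of the omegas determine the
  occupation numbers.\<close>

lemma qj_pow_inj: "qj eps j ^ a = qj eps j ^ b \<Longrightarrow> a = b"
proof -
  assume h: "qj eps j ^ a = qj eps j ^ b"
  have "\<bar>qj eps j\<bar> ^ a = \<bar>qj eps j\<bar> ^ b" using h by (metis power_abs)
  moreover have "\<bar>qj eps j\<bar> = qq \<or> \<bar>qj eps j\<bar> = inverse qq"
    using qq_pos by (auto simp: qj_def)
  ultimately show "a = b"
    by (auto simp: qq_pow_inj power_inverse)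
qed

text \<open>The powers of \<open>q\<close> are chosen such that the form with \<open>\<langle>P, P\<rangle> = nrm P\<close> makes \<open>e\<^sub>i\<close> adjoint to
  \<open>q\<^sub>i f\<^sub>i k\<^sub>i\<^sup>-\<^sup>1\<close>; see \<open>move_coeff_adjoint\<close>.\<close>

definition qfac :: "nat \<Rightarrow> K" where
  "qfac k = (\<Prod>j<k. qint (int (Suc j)) * qq ^ j)"

lemma qfac_0 [simp]: "qfac 0 = 1" and qfac_Suc: "qfac (Suc k) = qfac k * (qint (int (Suc k)) * qq ^ k)"
  by (simp_all add: qfac_def)

lemma qfac_nz [simp]: "qfac k \<noteq> 0"
  by (simp add: qfac_def qint_nz del: of_nat_Suc)

definition nrm :: "nat \<Rightarrow> (nat \<Rightarrow> nat) \<Rightarrow> K" where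
  "nrm n P = (\<Prod>i\<in>{1..n}. qfac (P i))"

lemma nrm_nz [simp]: "nrm n P \<noteq> 0"
  by (simp add: nrm_def)

text \<open>With spectral parameter 1, \<open>e\<close> and \<open>f\<close> share this coefficient
  for moving a box from \<open>b\<close> to \<open>a\<close>; they differ only in which of the two
  adjacent sites is the target.\<close>

definition hop :: "(nat \<Rightarrow> nat) \<Rightarrow> nat \<Rightarrow> nat \<Rightarrow> K" where
  "hop Q a b = qq powi (int (Q b) - int (Q a) - 1) * qint (int (Q b))"

lemma shift_same: "a \<noteq> b \<Longrightarrow> shift P a b a = P a + 1" "shift P a b b = P b - 1"
  and shift_other: "i \<noteq> a \<Longrightarrow> i \<noteq> b \<Longrightarrow> shift P a b i = P i"
  by (auto simp: shift_def)

lemma shift_shift: "a \<noteq> b \<Longrightarrow> P b \<ge> 1 \<Longrightarrow> shift (shift P a b) b a = P"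
  by (auto simp: shift_def)

text \<open>The quotient of the two norms cancels the power of q and the q-integer of the source
  site, leaving only the q-integer of the new occupation of the target.\<close>

lemma nrm_hop:
  assumes "a \<in> {1..n}" "b \<in> {1..n}" "a \<noteq> b" "Q b \<ge> 1"
  shows "nrm n (shift Q a b) * hop Q a b = qint (int (Q a + 1)) * nrm n Q"
proof -
  define X where "X = (\<Prod>i\<in>{1..n} - {a} - {b}. qfac (Q i))"
  have s: "nrm n P = qfac (P a) * (qfac (P b) * (\<Prod>i\<in>{1..n} - {a} - {b}. qfac (P i)))" for P
    unfolding nrm_def using assms
    by (subst prod.remove[of _ a]; simp) (subst prod.remove[of _ b]; simp)
  have 1: "nrm n Q = qfac (Q a) * (qfac (Q b) * X)" by (simp add: s X_def)
  have "(\<Prod>i\<in>{1..n} - {a} - {b}. qfac (shift Q a b i)) = X"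
    unfolding X_def by (rule prod.cong) (auto simp: shift_other)
  then have 2: "nrm n (shift Q a b) = qfac (Suc (Q a)) * (qfac (Q b - 1) * X)"
    using assms by (simp add: s shift_same)
  obtain k where k: "Q b = Suc k" using assms(4) by (cases "Q b") auto
  have "qq powi (int (Suc k) - int (Q a) - 1) * qq ^ Q a = qq ^ k"
    by (simp add: power_int_diff)
  then show ?thesis
    unfolding 1 2 hop_def k by (simp add: qfac_Suc field_simps del: of_nat_Suc)
qed

subsection \<open>Action of the generators in rescaled coordinates\<close>

text \<open>Sites are numbered 1 to n but generators 0 to n - 1. Site \<open>s\<close> stands for
  the generator with index \<open>s mod n\<close>, so site \<open>n\<close> gives index 0.\<close>

definition cyc_succ :: "nat \<Rightarrow> nat \<Rightarrow> nat" where
  "cyc_succ n s = ix n (s + 1)"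

definition move_coeff :: "nat \<Rightarrow> (nat \<Rightarrow> nat) \<Rightarrow> nat \<Rightarrow> nat \<Rightarrow> (nat \<Rightarrow> nat) \<Rightarrow> (nat \<Rightarrow> nat) \<Rightarrow> K" where
  "move_coeff n eps a b P Q =
     (if 1 \<le> Q b \<and> shift Q a b \<in> Zplus n eps \<and> P = shift Q a b then hop Q a b else 0)"

lemma ix_mod [simp]: "s \<in> {1..n} \<Longrightarrow> ix n (s mod n) = s"
  by (cases "s = n") (auto simp: ix_def)

lemma ix_mod_Suc: "s \<in> {1..n} \<Longrightarrow> ix n (s mod n + 1) = cyc_succ n s"
  by (simp add: ix_def cyc_succ_def mod_simps)

lemma ix_range: "n \<ge> 1 \<Longrightarrow> ix n i \<in> {1..n}"
  by (auto simp: ix_def Suc_le_eq less_imp_le)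

lemma cyc_succ_range: "n \<ge> 1 \<Longrightarrow> cyc_succ n s \<in> {1..n}"
  unfolding cyc_succ_def by (rule ix_range)

lemma cyc_succ_neq: "n \<ge> 2 \<Longrightarrow> s \<in> {1..n} \<Longrightarrow> cyc_succ n s \<noteq> s"
  by (cases "s = n"; cases "Suc s = n") (auto simp: cyc_succ_def ix_def mod_Suc)

lemma Ecoef_move_coeff: "s \<in> {1..n} \<Longrightarrow> Ecoef n eps 1 (s mod n) P Q = move_coeff n eps s (cyc_succ n s) P Q"
  using ix_mod_Suc[of s n] by (simp add: Ecoef_def move_coeff_def hop_def Let_def)

lemma Fcoef_move_coeff: "s \<in> {1..n} \<Longrightarrow> Fcoef n eps 1 (s mod n) P Q = move_coeff n eps (cyc_succ n s) s P Q"
  using ix_mod_Suc[of s n] by (simp add: Fcoef_def move_coeff_def hop_def Let_def)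

lemma k_ev_eq: "s \<in> {1..n} \<Longrightarrow> k_ev n eps (s mod n) P =
    qj eps s ^ P s / qj eps (cyc_succ n s) ^ P (cyc_succ n s)"
  using ix_mod_Suc[of s n] by (simp add: k_ev_def omega_ev_def)

lemma Wbasis_iff: "P \<in> Wbasis n eps s \<longleftrightarrow>
    (\<forall>i. i \<notin> {1..n} \<longrightarrow> P i = 0) \<and> (\<forall>i\<in>{1..n}. eps i = 1 \<longrightarrow> P i \<le> 1) \<and> (\<Sum>i\<in>{1..n}. P i) = s"
  by (auto simp: Wbasis_def Zplus_def)

lemma sum_shift:
  assumes "a \<in> {1..n}" "b \<in> {1..n}" "a \<noteq> b" "P b \<ge> 1"
  shows "(\<Sum>i\<in>{1..n}. shift P a b i) = (\<Sum>i\<in>{1..n}. P i)"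
proof -
  have s: "(\<Sum>i\<in>{1..n}. Q i) = Q a + (Q b + (\<Sum>i\<in>{1..n} - {a} - {b}. Q i))" for Q :: "nat \<Rightarrow> nat"
    using assms by (subst sum.remove[of _ a]; simp) (subst sum.remove[of _ b]; simp)
  have "(\<Sum>i\<in>{1..n} - {a} - {b}. shift P a b i) = (\<Sum>i\<in>{1..n} - {a} - {b}. P i)"
    by (rule sum.cong) (auto simp: shift_other)
  then show ?thesis using assms by (subst (1 2) s) (simp add: shift_same)
qed

lemma shift_Wbasis:
  assumes "P \<in> Wbasis n eps s" "a \<in> {1..n}" "b \<in> {1..n}" "a \<noteq> b" "P b \<ge> 1" "eps a = 1 \<Longrightarrow> P a = 0"
  shows "shift P a b \<in> Wbasis n eps s"
  using assms sum_shift[of a n b P] unfolding Wbasis_iff by (auto simp: shift_def)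

lemma finite_Wbasis: "finite (Wbasis n eps s)"
proof (rule finite_subset)
  show "Wbasis n eps s \<subseteq> {f. \<forall>x. (x \<in> {1..n} \<longrightarrow> f x \<in> {0..s}) \<and> (x \<notin> {1..n} \<longrightarrow> f x = 0)}"
    by (auto simp: Wbasis_iff member_le_sum)
  show "finite {f. \<forall>x. (x \<in> {1..n} \<longrightarrow> f x \<in> {0..s}) \<and> (x \<notin> {1..n} \<longrightarrow> f x = (0::nat))}"
    by (rule finite_set_of_finite_funs) auto
qed

lemma finite_TBasis [simp]: "finite (TBasis n eps l m)"
  by (simp add: TBasis_def finite_Wbasis)

text \<open>Row \<open>P\<close> has at most one nonzero entry, at the configuration where the box
  has been put back. If there is none, then either \<open>P a = 0\<close> and the q-integer
  vanishes, or that configuration is inadmissible and \<open>f\<close> vanishes on it.\<close>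

lemma sum_move_coeff:
  assumes "a \<in> {1..n}" "b \<in> {1..n}" "a \<noteq> b" "P \<in> Wbasis n eps s"
    and f: "\<And>Q. Q \<notin> Wbasis n eps s \<Longrightarrow> f Q = 0"
  shows "nrm n P * (\<Sum>Q\<in>Wbasis n eps s. move_coeff n eps a b P Q * f Q)
    = qint (int (P a)) * nrm n (shift P b a) * f (shift P b a)"
proof (cases "P a \<ge> 1 \<and> shift P b a \<in> Wbasis n eps s")
  case True
  let ?Q = "shift P b a"
  have Q_back: "shift ?Q a b = P" using assms True by (intro shift_shift) auto
  have "move_coeff n eps a b P Q * f Q = (if Q = ?Q then hop ?Q a b * f ?Q else 0)" for Q
  proof (cases "Q = ?Q")
    case eqQ: True
    show ?thesis using assms(4) unfolding eqQ move_coeff_def Q_back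
      using assms(3) by (simp add: shift_same Wbasis_def)
  next
    case False
    then have "Q b \<ge> 1 \<longrightarrow> P \<noteq> shift Q a b" using shift_shift[of a b Q] assms(3) by auto
    then show ?thesis using False by (auto simp: move_coeff_def)
  qed
  then have "(\<Sum>Q\<in>Wbasis n eps s. move_coeff n eps a b P Q * f Q) = hop ?Q a b * f ?Q"
    using True by (simp add: finite_Wbasis)
  moreover have "nrm n P * hop ?Q a b = qint (int (P a)) * nrm n ?Q"
    using nrm_hop[of a n b ?Q] assms True unfolding Q_back by (simp add: shift_same)
  ultimately show ?thesis by (metis mult.assoc)
next
  case False
  have "move_coeff n eps a b P Q * f Q = 0" if "Q \<in> Wbasis n eps s" for Q
  proof (rule ccontr)
    assume "move_coeff n eps a b P Q * f Q \<noteq> 0"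
    then have h: "Q b \<ge> 1" "P = shift Q a b" by (auto simp: move_coeff_def split: if_splits)
    then have "Q = shift P b a" using shift_shift[of a b Q] assms(3) by auto
    moreover have "P a \<ge> 1" using h assms(3) by (simp add: shift_same)
    ultimately show False using False that by auto
  qed
  then have "(\<Sum>Q\<in>Wbasis n eps s. move_coeff n eps a b P Q * f Q) = 0" by (intro sum.neutral) blast
  then show ?thesis using False f by (cases "P a") auto
qed

lemma move_coeff_adjoint:
  assumes "a \<in> {1..n}" "b \<in> {1..n}" "a \<noteq> b" "P \<in> Wbasis n eps s" "Q \<in> Wbasis n eps s"
    and e: "\<forall>i\<in>{1..n}. eps i \<in> {0, 1}"
  shows "nrm n P * move_coeff n eps a b P Q
    = qj eps a * (qj eps b ^ P b / qj eps a ^ P a) * (nrm n Q * move_coeff n eps b a Q P)"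
proof (cases "Q b \<ge> 1 \<and> P = shift Q a b")
  case True
  then have P: "P a = Q a + 1" "P b = Q b - 1" "shift P b a = Q"
    using assms(3) shift_shift[of a b Q] by (auto simp: shift_same)
  obtain k where k: "Q b = Suc k" using True by (cases "Q b") auto
  have m1: "move_coeff n eps a b P Q = hop Q a b" using True assms(4) by (auto simp: move_coeff_def Wbasis_def)
  have m2: "move_coeff n eps b a Q P = hop P b a" using P assms(5) by (auto simp: move_coeff_def Wbasis_def)
  have n1: "nrm n P * hop Q a b = qint (int (Q a + 1)) * nrm n Q"
    using nrm_hop[of a n b Q] assms True by auto
  \<comment> \<open>An odd site can only be filled from 0 to 1 or emptied from 1 to 0. The prefactor
    \<open>qj eps a\<close> is exactly what makes the odd and the even case give the same power of
    q.\<close>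
  have "eps a = 0 \<or> eps a = 1 \<and> Q a = 0" using assms(1,4) e P(1) by (force simp: Wbasis_iff)
  then have A: "qj eps a / qj eps a ^ P a = inverse qq ^ Q a"
    by (auto simp: P(1) qj_def power_inverse field_simps)
  have "eps b = 0 \<or> eps b = 1 \<and> P b = 0" using assms(2,5) e P(2) k by (force simp: Wbasis_iff)
  then have B: "qj eps b ^ P b = qq ^ k"
    using P(2) k by (auto simp: qj_def)
  have "hop P b a = qq powi (int (Q a) - int k) * qint (int (Q a + 1))"
    by (simp add: hop_def P k)
  also have "qq powi (int (Q a) - int k) = qq ^ Q a / qq ^ k" by (simp add: power_int_diff)
  finally have "qj eps a * (qj eps b ^ P b / qj eps a ^ P a) * hop P b a = qint (int (Q a + 1))"
    using A B by (simp add: field_simps power_inverse)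
  then show ?thesis unfolding m1 m2 n1 by (metis mult.assoc mult.commute)
next
  case False
  then have "move_coeff n eps a b P Q = 0" by (auto simp: move_coeff_def)
  moreover have "move_coeff n eps b a Q P = 0"
  proof (rule ccontr)
    assume "move_coeff n eps b a Q P \<noteq> 0"
    then have h: "P a \<ge> 1" "Q = shift P b a" by (auto simp: move_coeff_def split: if_splits)
    then have "P = shift Q a b" using shift_shift[of b a P] assms(3) by auto
    moreover have "Q b \<ge> 1" using h assms(3) by (simp add: shift_same)
    ultimately show False using False by auto
  qed
  ultimately show ?thesis by simp
qed

text \<open>In coordinates rescaled by the norm, a generator that fills site \<open>a\<close> has the coefficient
  \<open>[P a]\<close>, which vanishes by itself when \<open>P a = 0\<close>, so no truncated subtraction gets in the way.\<close>

definition coord :: "nat \<Rightarrow> (idx2 \<Rightarrow> K) \<Rightarrow> (nat \<Rightarrow> nat) \<Rightarrow> (nat \<Rightarrow> nat) \<Rightarrow> K" where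
  "coord n v P R = nrm n P * nrm n R * v (P, R)"

lemma sum_TBasis_fst:
  fixes v :: "idx2 \<Rightarrow> K"
  assumes "R \<in> Wbasis n eps m"
  shows "(\<Sum>r\<in>TBasis n eps l m. (C (fst r) * (if R = snd r then c else 0)) * v r)
    = c * (\<Sum>Q\<in>Wbasis n eps l. C Q * v (Q, R))" (is "?L = _")
proof -
  have "?L = (\<Sum>Q\<in>Wbasis n eps l. \<Sum>S\<in>Wbasis n eps m. (C Q * (if R = S then c else 0)) * v (Q, S))"
    unfolding TBasis_def by (subst sum.cartesian_product) (auto intro!: sum.cong)
  also have "\<dots> = (\<Sum>Q\<in>Wbasis n eps l. \<Sum>S\<in>Wbasis n eps m. if R = S then C Q * c * v (Q, S) else 0)"
    by (intro sum.cong) auto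
  also have "\<dots> = (\<Sum>Q\<in>Wbasis n eps l. C Q * c * v (Q, R))"
    using assms by (simp add: finite_Wbasis)
  finally show ?thesis by (simp add: sum_distrib_left ac_simps)
qed

lemma sum_TBasis_snd:
  fixes v :: "idx2 \<Rightarrow> K"
  assumes "P \<in> Wbasis n eps l"
  shows "(\<Sum>r\<in>TBasis n eps l m. ((if P = fst r then c else 0) * C (snd r)) * v r)
    = c * (\<Sum>Q\<in>Wbasis n eps m. C Q * v (P, Q))" (is "?L = _")
proof -
  have "?L = (\<Sum>S\<in>Wbasis n eps l. \<Sum>Q\<in>Wbasis n eps m. ((if P = S then c else 0) * C Q) * v (S, Q))"
    unfolding TBasis_def by (subst sum.cartesian_product) (auto intro!: sum.cong)
  also have "\<dots> = (\<Sum>S\<in>Wbasis n eps l. if P = S then c * (\<Sum>Q\<in>Wbasis n eps m. C Q * v (S, Q)) else 0)"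
    by (intro sum.cong) (auto simp: sum_distrib_left ac_simps)
  finally show ?thesis using assms by (simp add: finite_Wbasis)
qed

text \<open>The scalars \<open>c\<close> and \<open>d\<close> stand for the eigenvalue of
  \<open>k\<close> or its inverse in the coproduct: \<open>e\<close> has \<open>c = 1\<close>,
  \<open>f\<close> has \<open>d = 1\<close>.\<close>

lemma coord_tensor:
  assumes ab: "a \<in> {1..n}" "b \<in> {1..n}" "a \<noteq> b" and PR: "(P, R) \<in> TBasis n eps l m"
    and v: "v \<in> vspace (TBasis n eps l m)"
    and C: "\<And>r. C (P, R) r = move_coeff n eps a b P (fst r) * (if R = snd r then c else 0)
        + (if P = fst r then d else 0) * move_coeff n eps a b R (snd r)"
  shows "coord n (act (TBasis n eps l m) C v) P R
    = qint (int (P a)) * c * coord n v (shift P b a) R + d * qint (int (R a)) * coord n v P (shift R b a)"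
proof -
  have P: "P \<in> Wbasis n eps l" and R: "R \<in> Wbasis n eps m" using PR by (auto simp: TBasis_def)
  have v1: "v (Q, R) = 0" if "Q \<notin> Wbasis n eps l" for Q
    using v that by (auto simp: vspace_def TBasis_def)
  have v2: "v (P, Q) = 0" if "Q \<notin> Wbasis n eps m" for Q
    using v that by (auto simp: vspace_def TBasis_def)
  have s1: "nrm n P * (\<Sum>Q\<in>Wbasis n eps l. move_coeff n eps a b P Q * v (Q, R))
      = qint (int (P a)) * nrm n (shift P b a) * v (shift P b a, R)"
    using sum_move_coeff[OF ab P, of "\<lambda>Q. v (Q, R)"] v1 by simp
  have s2: "nrm n R * (\<Sum>Q\<in>Wbasis n eps m. move_coeff n eps a b R Q * v (P, Q))
      = qint (int (R a)) * nrm n (shift R b a) * v (P, shift R b a)"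
    using sum_move_coeff[OF ab R, of "\<lambda>Q. v (P, Q)"] v2 by simp
  have "act (TBasis n eps l m) C v (P, R)
      = c * (\<Sum>Q\<in>Wbasis n eps l. move_coeff n eps a b P Q * v (Q, R))
        + d * (\<Sum>Q\<in>Wbasis n eps m. move_coeff n eps a b R Q * v (P, Q))"
    using PR by (simp add: act_def C distrib_right sum.distrib sum_TBasis_fst[OF R] sum_TBasis_snd[OF P])
  then have "coord n (act (TBasis n eps l m) C v) P R
      = c * nrm n R * (nrm n P * (\<Sum>Q\<in>Wbasis n eps l. move_coeff n eps a b P Q * v (Q, R)))
        + d * nrm n P * (nrm n R * (\<Sum>Q\<in>Wbasis n eps m. move_coeff n eps a b R Q * v (P, Q)))"
    by (simp add: coord_def algebra_simps)
  then show ?thesis unfolding s1 s2 by (simp add: coord_def algebra_simps)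
qed

lemma coord_TE:
  assumes "n \<ge> 2" "s \<in> {1..n}" "(P, R) \<in> TBasis n eps l m" "v \<in> vspace (TBasis n eps l m)"
    and t: "t = cyc_succ n s"
  shows "coord n (act (TBasis n eps l m) (TE n eps 1 1 (s mod n)) v) P R
    = qint (int (P s)) * coord n v (shift P t s) R
      + (qj eps t ^ P t / qj eps s ^ P s) * qint (int (R s)) * coord n v P (shift R t s)"
  by (subst coord_tensor[where a = s and b = t and c = 1 and d = "qj eps t ^ P t / qj eps s ^ P s"])
    (use assms cyc_succ_range[of n s] cyc_succ_neq[of n s] in
      \<open>auto simp: TE_def Ecoef_move_coeff k_ev_eq\<close>)

lemma coord_TF:
  assumes "n \<ge> 2" "s \<in> {1..n}" "(P, R) \<in> TBasis n eps l m" "v \<in> vspace (TBasis n eps l m)"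
    and t: "t = cyc_succ n s"
  shows "coord n (act (TBasis n eps l m) (TF n eps 1 1 (s mod n)) v) P R
    = qint (int (P t)) * (qj eps s ^ R s / qj eps t ^ R t) * coord n v (shift P s t) R
      + qint (int (R t)) * coord n v P (shift R s t)"
  by (subst coord_tensor[where a = t and b = s and d = 1 and c = "qj eps s ^ R s / qj eps t ^ R t"])
    (use assms cyc_succ_range[of n s] cyc_succ_neq[of n s] in
      \<open>auto simp: TF_def Fcoef_move_coeff k_ev_eq\<close>)

subsection \<open>Weight vectors and transport of boxes\<close>

text \<open>A weight is encoded as the total occupation of each site instead of a list of
  eigenvalues. The zero vector is homogeneous of every weight.\<close>

definition homog :: "(nat \<Rightarrow> nat) \<Rightarrow> (idx2 \<Rightarrow> K) \<Rightarrow> bool" where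
  "homog \<nu> v \<longleftrightarrow> (\<forall>P R. v (P, R) \<noteq> 0 \<longrightarrow> (\<forall>i. P i + R i = \<nu> i))"

lemma act_TOmega:
  assumes "v \<in> vspace B" "finite B"
  shows "act B (TOmega eps j) v p = qj eps j ^ (fst p j + snd p j) * v p"
proof (cases "p \<in> B")
  case True
  have "(\<Sum>r\<in>B. TOmega eps j p r * v r)
      = (\<Sum>r\<in>B. if p = r then qj eps j ^ (fst r j + snd r j) * v r else 0)"
    by (rule sum.cong) (auto simp: TOmega_def omega_ev_def power_add)
  then show ?thesis using True assms(2) by (simp add: act_def)
next
  case False
  then show ?thesis using assms by (cases p) (simp add: act_def vspace_def)
qed

lemma act_TOmegaInv:
  assumes "v \<in> vspace B" "finite B"
  shows "act B (TOmegaInv eps j) v p = inverse (qj eps j ^ (fst p j + snd p j)) * v p"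
proof (cases "p \<in> B")
  case True
  have "(\<Sum>r\<in>B. TOmegaInv eps j p r * v r)
      = (\<Sum>r\<in>B. if p = r then inverse (qj eps j ^ (fst r j + snd r j)) * v r else 0)"
    by (rule sum.cong) (auto simp: TOmegaInv_def omega_ev_def power_add)
  then show ?thesis using True assms(2) by (simp add: act_def)
next
  case False
  then show ?thesis using assms by (cases p) (simp add: act_def vspace_def)
qed

locale tensor_submodule =
  fixes n l m :: nat and eps :: "nat \<Rightarrow> nat" and S :: "(idx2 \<Rightarrow> K) set"
  assumes n2: "2 \<le> n"
    and eps01: "\<forall>i\<in>{1..n}. eps i \<in> {0, 1}"
    and sub: "is_submodule (TBasis n eps l m) (generators n eps 1 1) S"
begin

abbreviation "B \<equiv> TBasis n eps l m"
abbreviation "D \<equiv> coord n"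
abbreviation "Q \<equiv> qj eps"

lemma S_vspace: "v \<in> S \<Longrightarrow> v \<in> vspace B"
  and S_zero: "(\<lambda>p. 0) \<in> S"
  and S_add: "u \<in> S \<Longrightarrow> v \<in> S \<Longrightarrow> (\<lambda>p. u p + v p) \<in> S"
  and S_scale: "v \<in> S \<Longrightarrow> (\<lambda>p. c * v p) \<in> S"
  and S_act: "v \<in> S \<Longrightarrow> C \<in> generators n eps 1 1 \<Longrightarrow> act B C v \<in> S"
  using sub unfolding is_submodule_def by blast+

lemma S_TOmega: "v \<in> S \<Longrightarrow> j \<in> {1..n} \<Longrightarrow> act B (TOmega eps j) v \<in> S"
  and S_TOmegaInv: "v \<in> S \<Longrightarrow> j \<in> {1..n} \<Longrightarrow> act B (TOmegaInv eps j) v \<in> S"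
  and S_TE: "v \<in> S \<Longrightarrow> j \<in> {1..n} \<Longrightarrow> act B (TE n eps 1 1 (j mod n)) v \<in> S"
  and S_TF: "v \<in> S \<Longrightarrow> j \<in> {1..n} \<Longrightarrow> act B (TF n eps 1 1 (j mod n)) v \<in> S"
proof -
  assume h: "v \<in> S" "j \<in> {1..n}"
  have "j mod n \<in> {0..<n}" using n2 by simp
  then have "{TOmega eps j, TOmegaInv eps j, TE n eps 1 1 (j mod n), TF n eps 1 1 (j mod n)}
      \<subseteq> generators n eps 1 1"
    using h(2) unfolding generators_def by blast
  then show "act B (TOmega eps j) v \<in> S" "act B (TOmegaInv eps j) v \<in> S"
      "act B (TE n eps 1 1 (j mod n)) v \<in> S" "act B (TF n eps 1 1 (j mod n)) v \<in> S"
    by (auto intro!: S_act[OF h(1)])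
qed

lemma S_off: "v \<in> S \<Longrightarrow> p \<notin> B \<Longrightarrow> v p = 0"
  using S_vspace by (cases p) (auto simp: vspace_def)

lemma D_off: "v \<in> S \<Longrightarrow> (P, R) \<notin> B \<Longrightarrow> D v P R = 0"
  using S_off by (simp add: coord_def)

lemma TBasis_odd:
  assumes "(P, R) \<in> B" "x \<in> {1..n}" "eps x = 1"
  shows "P x \<le> 1" "R x \<le> 1"
  using assms by (auto simp: TBasis_def Wbasis_def Zplus_def)

lemma D_over:
  assumes "v \<in> S" "x \<in> {1..n}" "eps x = 1" "P x > 1 \<or> R x > 1"
  shows "D v P R = 0"
  using D_off[OF assms(1)] TBasis_odd[OF _ assms(2,3)] assms(4) by (meson not_less)

lemma shift_TBasis:
  assumes "(P, R) \<in> B" "a \<in> {1..n}" "b \<in> {1..n}" "a \<noteq> b"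
  shows "P b \<ge> 1 \<Longrightarrow> (eps a = 1 \<Longrightarrow> P a = 0) \<Longrightarrow> (shift P a b, R) \<in> B"
    and "R b \<ge> 1 \<Longrightarrow> (eps a = 1 \<Longrightarrow> R a = 0) \<Longrightarrow> (P, shift R a b) \<in> B"
  using assms shift_Wbasis by (auto simp: TBasis_def)

text \<open>A nonzero vector of minimal support works: if two positions in its support had different
  totals at \<open>j\<close>, subtracting from \<open>omega_j\<close> its eigenvalue at one of them
  would give a nonzero vector of smaller support.\<close>

lemma weight_vector:
  assumes "S \<noteq> {\<lambda>p. 0}"
  obtains v \<nu> where "v \<in> S" "v \<noteq> (\<lambda>p. 0)" "homog \<nu> v"
proof -
  define supp :: "(idx2 \<Rightarrow> K) \<Rightarrow> idx2 set" where "supp v = {p. v p \<noteq> 0}" for v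
  have fin: "finite (supp v)" if "v \<in> S" for v
    by (rule finite_subset[of _ B]) (use S_off[OF that] in \<open>auto simp: supp_def\<close>)
  obtain v0 where "v0 \<in> S \<and> v0 \<noteq> (\<lambda>p. 0)" using assms S_zero by blast
  from ex_has_least_nat[where P = "\<lambda>v. v \<in> S \<and> v \<noteq> (\<lambda>p. 0)", OF this, of "\<lambda>v. card (supp v)"]
  obtain v where v: "v \<in> S" "v \<noteq> (\<lambda>p. 0)"
    and min: "\<And>u. u \<in> S \<Longrightarrow> u \<noteq> (\<lambda>p. 0) \<Longrightarrow> card (supp v) \<le> card (supp u)" by blast
  obtain p0 where p0: "v p0 \<noteq> 0" using v(2) by blast
  have "homog (\<lambda>i. fst p0 i + snd p0 i) v"
    unfolding homog_def
  proof (intro allI impI, rule ccontr)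
    fix P R j assume PR: "v (P, R) \<noteq> 0" and j: "P j + R j \<noteq> fst p0 j + snd p0 j"
    have "(P, R) \<in> B" "p0 \<in> B" using S_off[OF v(1)] PR p0 by blast+
    then have "j \<notin> {1..n} \<Longrightarrow> P j + R j = fst p0 j + snd p0 j"
      by (simp add: TBasis_def Wbasis_iff mem_Times_iff)
    then have jn: "j \<in> {1..n}" using j by blast
    define c where "c = Q j ^ (fst p0 j + snd p0 j)"
    define u where "u = (\<lambda>p. act B (TOmega eps j) v p + (- c) * v p)"
    have u: "u p = (Q j ^ (fst p j + snd p j) - c) * v p" for p
      by (simp add: u_def act_TOmega[OF S_vspace[OF v(1)]] algebra_simps)
    have uS: "u \<in> S" unfolding u_def by (intro S_add S_TOmega S_scale v jn)
    have "u (P, R) \<noteq> 0" using PR j qj_pow_inj by (auto simp: u c_def)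
    then have "card (supp v) \<le> card (supp u)" by (intro min uS) auto
    moreover have "supp u \<subset> supp v" using p0 by (auto simp: supp_def u c_def)
    then have "card (supp u) < card (supp v)" by (rule psubset_card_mono[OF fin[OF v(1)]])
    ultimately show False by simp
  qed
  with v show ?thesis using that by blast
qed

lemma D_homog: "homog \<nu> v \<Longrightarrow> D v P R \<noteq> 0 \<Longrightarrow> P i + R i = \<nu> i"
  by (auto simp: homog_def coord_def)

text \<open>Only supports matter here, so \<open>x\<close> and \<open>y\<close> are arbitrary. A
  nonzero q-integer guarantees a box at \<open>c\<close>, so the truncated subtraction in
  \<open>shift\<close> is a genuine one.\<close>

lemma homog_shift:
  assumes "b \<noteq> c" "\<nu> b \<ge> 1" "w \<in> S" "homog \<nu> v"
    and "\<And>P R. (P, R) \<in> B \<Longrightarrow> D w P R = qint (int (P c)) * x P R * D v (shift P b c) R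
        + y P R * qint (int (R c)) * D v P (shift R b c)"
  shows "homog (shift \<nu> c b) w"
  unfolding homog_def
proof (intro allI impI)
  fix P R i assume w: "w (P, R) \<noteq> 0"
  then have "(P, R) \<in> B" using S_off[OF assms(3)] by blast
  from assms(5)[OF this] w
  have "qint (int (P c)) * x P R * D v (shift P b c) R \<noteq> 0
      \<or> y P R * qint (int (R c)) * D v P (shift R b c) \<noteq> 0"
    by (auto simp: coord_def)
  then show "P i + R i = shift \<nu> c b i"
  proof
    assume "qint (int (P c)) * x P R * D v (shift P b c) R \<noteq> 0"
    then have "P c \<ge> 1" "\<And>i. shift P b c i + R i = \<nu> i"
      using D_homog[OF assms(4)] by (cases "P c"; force)+
    from this(1) this(2)[of i] show ?thesis using assms(1,2)
      by (auto simp: shift_def split: if_splits)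
  next
    assume "y P R * qint (int (R c)) * D v P (shift R b c) \<noteq> 0"
    then have "R c \<ge> 1" "\<And>i. P i + shift R b c i = \<nu> i"
      using D_homog[OF assms(4)] by (cases "R c"; force)+
    from this(1) this(2)[of i] show ?thesis using assms(1,2)
      by (auto simp: shift_def split: if_splits)
  qed
qed

text \<open>Realised by products of generators \<open>f\<close> along the cyclic path from \<open>b\<close> to \<open>c\<close>, which act like a
  single \<open>f\<close> moving a box from \<open>b\<close> to \<open>c\<close> when the sites in between are empty or full.\<close>

definition carries :: "(nat \<Rightarrow> nat) \<Rightarrow> nat \<Rightarrow> nat \<Rightarrow> bool" where
  "carries \<nu> b c \<longleftrightarrow> (\<forall>v\<in>S. homog \<nu> v \<longrightarrow> (\<exists>w\<in>S. homog (shift \<nu> c b) w \<and>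
     (\<forall>P R. (P, R) \<in> B \<longrightarrow> (\<forall>i. P i + R i = shift \<nu> c b i) \<longrightarrow>
       D w P R = qint (int (P c)) * (Q b ^ R b / Q c ^ R c) * D v (shift P b c) R
         + qint (int (R c)) * D v P (shift R b c))))"

lemma carriesE:
  assumes "carries \<nu> b c" "v \<in> S" "homog \<nu> v"
  obtains w where "w \<in> S" "homog (shift \<nu> c b) w"
    "\<And>P R. (P, R) \<in> B \<Longrightarrow> (\<And>i. P i + R i = shift \<nu> c b i) \<Longrightarrow>
       D w P R = qint (int (P c)) * (Q b ^ R b / Q c ^ R c) * D v (shift P b c) R
         + qint (int (R c)) * D v P (shift R b c)"
  using assms unfolding carries_def by blast

lemma carries_succ:
  assumes "s \<in> {1..n}" "\<nu> s \<ge> 1"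
  shows "carries \<nu> s (cyc_succ n s)"
  unfolding carries_def
proof (intro ballI impI)
  fix v assume v: "v \<in> S" "homog \<nu> v"
  let ?w = "act B (TF n eps 1 1 (s mod n)) v"
  note D = coord_TF[OF n2 assms(1) _ S_vspace[OF v(1)] refl]
  have "homog (shift \<nu> (cyc_succ n s) s) ?w"
    by (rule homog_shift[where v = v and y = "\<lambda>P R. 1"
          and x = "\<lambda>P R. Q s ^ R s / Q (cyc_succ n s) ^ R (cyc_succ n s)"])
      (use assms cyc_succ_neq[OF n2 assms(1)] v S_TF in \<open>simp_all add: D\<close>)
  then show "\<exists>w\<in>S. homog (shift \<nu> (cyc_succ n s) s) w \<and>
     (\<forall>P R. (P, R) \<in> B \<longrightarrow> (\<forall>i. P i + R i = shift \<nu> (cyc_succ n s) s i) \<longrightarrow>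
       D w P R = qint (int (P (cyc_succ n s))) * (Q s ^ R s / Q (cyc_succ n s) ^ R (cyc_succ n s)) * D v (shift P s (cyc_succ n s)) R
         + qint (int (R (cyc_succ n s))) * D v P (shift R s (cyc_succ n s)))"
    using S_TF[OF v(1) assms(1)] D by blast
qed

text \<open>After the first step the travelling box is the only one at \<open>c\<close>. A term in
  which it arrives in one tensor factor and leaves from the other contains the q-integer of 0, so no
  mixed terms occur.\<close>

lemma carries_empty:
  assumes "b \<in> {1..n}" "c \<in> {1..n}" "d \<in> {1..n}" "b \<noteq> c" "c \<noteq> d" "b \<noteq> d"
    and "\<nu> b \<ge> 1" "\<nu> c = 0"
    and bc: "carries \<nu> b c" and cd: "carries (shift \<nu> c b) c d"
  shows "carries \<nu> b d"
  unfolding carries_def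
proof (intro ballI impI)
  fix v assume v: "v \<in> S" "homog \<nu> v"
  obtain w where w: "w \<in> S" "homog (shift \<nu> c b) w" and Dw: "\<And>P R. (P, R) \<in> B \<Longrightarrow>
      (\<And>i. P i + R i = shift \<nu> c b i) \<Longrightarrow> D w P R = qint (int (P c)) * (Q b ^ R b / Q c ^ R c) * D v (shift P b c) R
         + qint (int (R c)) * D v P (shift R b c)"
    using carriesE[OF bc v] by blast
  have wt: "shift (shift \<nu> c b) d c = shift \<nu> d b"
    using assms by (auto simp: shift_def)
  obtain w' where w': "w' \<in> S" "homog (shift \<nu> d b) w'" and Dw': "\<And>P R. (P, R) \<in> B \<Longrightarrow>
      (\<And>i. P i + R i = shift \<nu> d b i) \<Longrightarrow> D w' P R = qint (int (P d)) * (Q c ^ R c / Q d ^ R d) * D w (shift P c d) R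
         + qint (int (R d)) * D w P (shift R c d)"
    using carriesE[OF cd w] unfolding wt by blast
  have "D w' P R = qint (int (P d)) * (Q b ^ R b / Q d ^ R d) * D v (shift P b d) R
         + qint (int (R d)) * D v P (shift R b d)"
    if PR: "(P, R) \<in> B" and wPR: "\<And>i. P i + R i = shift \<nu> d b i" for P R
  proof -
    have c0: "P c = 0" "R c = 0" using wPR[of c] assms by (auto simp: shift_def)
    have P: "P \<in> Wbasis n eps l" and R: "R \<in> Wbasis n eps m" using PR by (auto simp: TBasis_def)
    have 1: "qint (int (P d)) * D w (shift P c d) R = qint (int (P d)) * Q b ^ R b * D v (shift P b d) R"
    proof (cases "P d \<ge> 1")
      case True
      have "(shift P c d, R) \<in> B"
        using shift_Wbasis[OF P, of c d] R assms True c0 by (auto simp: TBasis_def)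
      moreover have "shift P c d i + R i = shift \<nu> c b i" for i
        using wPR[of i] wPR[of d] True c0 assms by (auto simp: shift_def split: if_splits)
      ultimately have "D w (shift P c d) R = qint (int (shift P c d c)) * (Q b ^ R b / Q c ^ R c) * D v (shift (shift P c d) b c) R
         + qint (int (R c)) * D v (shift P c d) (shift R b c)" by (rule Dw)
      moreover have "shift (shift P c d) b c = shift P b d" using assms c0 by (auto simp: shift_def)
      ultimately show ?thesis using c0 assms by (simp add: shift_same)
    next
      case False
      then have "P d = 0" by simp
      then show ?thesis by simp
    qed
    have 2: "qint (int (R d)) * D w P (shift R c d) = qint (int (R d)) * D v P (shift R b d)"
    proof (cases "R d \<ge> 1")
      case True
      have "(P, shift R c d) \<in> B"
        using shift_Wbasis[OF R, of c d] P assms True c0 by (auto simp: TBasis_def)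
      moreover have "P i + shift R c d i = shift \<nu> c b i" for i
        using wPR[of i] wPR[of d] True c0 assms by (auto simp: shift_def split: if_splits)
      ultimately have "D w P (shift R c d) = qint (int (P c)) * (Q b ^ shift R c d b / Q c ^ shift R c d c) * D v (shift P b c) (shift R c d)
         + qint (int (shift R c d c)) * D v P (shift (shift R c d) b c)" by (rule Dw)
      moreover have "shift (shift R c d) b c = shift R b d" using assms c0 by (auto simp: shift_def)
      ultimately show ?thesis using c0 assms by (simp add: shift_same)
    next
      case False
      then have "R d = 0" by simp
      then show ?thesis by simp
    qed
    have "D w' P R = (qint (int (P d)) * D w (shift P c d) R) * (1 / Q d ^ R d)
         + qint (int (R d)) * D w P (shift R c d)"
      using Dw'[OF PR wPR] c0 by simp
    then show ?thesis unfolding 1 2 by simp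
  qed
  then show "\<exists>w\<in>S. homog (shift \<nu> d b) w \<and>
     (\<forall>P R. (P, R) \<in> B \<longrightarrow> (\<forall>i. P i + R i = shift \<nu> d b i) \<longrightarrow>
       D w P R = qint (int (P d)) * (Q b ^ R b / Q d ^ R d) * D v (shift P b d) R
         + qint (int (R d)) * D v P (shift R b d))"
    using w' by blast
qed

text \<open>Particle-hole dual of \<open>carries_empty\<close>, with the steps in the opposite
  order: \<open>c\<close> first gives a box to \<open>d\<close>, and then the box from
  \<open>b\<close> refills the hole. Mixed terms would overfill the odd site \<open>c\<close> and
  vanish by \<open>D_over\<close>; the factors \<open>Q c\<close> of the two steps cancel.\<close>

lemma carries_full:
  assumes "b \<in> {1..n}" "c \<in> {1..n}" "d \<in> {1..n}" "b \<noteq> c" "c \<noteq> d" "b \<noteq> d"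
    and "\<nu> b \<ge> 1" "\<nu> c = 2" "eps c = 1"
    and cd: "carries \<nu> c d" and bc: "carries (shift \<nu> d c) b c"
  shows "carries \<nu> b d"
  unfolding carries_def
proof (intro ballI impI)
  fix v assume v: "v \<in> S" "homog \<nu> v"
  obtain w where w: "w \<in> S" "homog (shift \<nu> d c) w" and Dw: "\<And>P R. (P, R) \<in> B \<Longrightarrow>
      (\<And>i. P i + R i = shift \<nu> d c i) \<Longrightarrow> D w P R = qint (int (P d)) * (Q c ^ R c / Q d ^ R d) * D v (shift P c d) R
         + qint (int (R d)) * D v P (shift R c d)"
    using carriesE[OF cd v] by blast
  have wt: "shift (shift \<nu> d c) c b = shift \<nu> d b"
    using assms by (auto simp: shift_def)
  obtain w' where w': "w' \<in> S" "homog (shift \<nu> d b) w'" and Dw': "\<And>P R. (P, R) \<in> B \<Longrightarrow>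
      (\<And>i. P i + R i = shift \<nu> d b i) \<Longrightarrow> D w' P R = qint (int (P c)) * (Q b ^ R b / Q c ^ R c) * D w (shift P b c) R
         + qint (int (R c)) * D w P (shift R b c)"
    using carriesE[OF bc w] unfolding wt by blast
  have "D w' P R = qint (int (P d)) * (Q b ^ R b / Q d ^ R d) * D v (shift P b d) R
         + qint (int (R d)) * D v P (shift R b d)"
    if PR: "(P, R) \<in> B" and wPR: "\<And>i. P i + R i = shift \<nu> d b i" for P R
  proof -
    have P: "P \<in> Wbasis n eps l" and R: "R \<in> Wbasis n eps m" using PR by (auto simp: TBasis_def)
    have "P c \<le> 1" "R c \<le> 1" using P R assms(2,9) by (auto simp: Wbasis_iff)
    moreover have "P c + R c = 2" using wPR[of c] assms by (auto simp: shift_def)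
    ultimately have c1: "P c = 1" "R c = 1" by auto
    have 1: "D w (shift P b c) R = qint (int (P d)) * (Q c / Q d ^ R d) * D v (shift P b d) R"
    proof (cases "eps b = 1 \<and> P b \<ge> 1")
      case True
      have "D w (shift P b c) R = 0" "D v (shift P b d) R = 0"
        by (rule D_over[where x = b]; use True assms(1,4,6) w v in \<open>simp add: shift_same\<close>)+
      then show ?thesis by simp
    next
      case False
      have "(shift P b c, R) \<in> B"
        using shift_Wbasis[OF P, of b c] R assms False c1 by (auto simp: TBasis_def)
      moreover have "shift P b c i + R i = shift \<nu> d c i" for i
        using wPR[of i] wPR[of c] c1 assms(4-8) by (auto simp: shift_def split: if_splits)
      ultimately have "D w (shift P b c) R = qint (int (shift P b c d)) * (Q c ^ R c / Q d ^ R d) * D v (shift (shift P b c) c d) R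
         + qint (int (R d)) * D v (shift P b c) (shift R c d)" by (rule Dw)
      moreover have "shift (shift P b c) c d = shift P b d" using assms c1 by (auto simp: shift_def)
      moreover have "D v (shift P b c) (shift R c d) = 0" by (rule D_over[where x = c]; use assms(2,4,5,9) c1 v in \<open>simp add: shift_same\<close>)
      ultimately show ?thesis using c1 assms(4-6) by (simp add: shift_other shift_same)
    qed
    have 2: "D w P (shift R b c) = qint (int (R d)) * D v P (shift R b d)"
    proof (cases "eps b = 1 \<and> R b \<ge> 1")
      case True
      have "D w P (shift R b c) = 0" "D v P (shift R b d) = 0"
        by (rule D_over[where x = b]; use True assms(1,4,6) w v in \<open>simp add: shift_same\<close>)+
      then show ?thesis by simp
    next
      case False
      have "(P, shift R b c) \<in> B"
        using shift_Wbasis[OF R, of b c] P assms False c1 by (auto simp: TBasis_def)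
      moreover have "P i + shift R b c i = shift \<nu> d c i" for i
        using wPR[of i] wPR[of c] c1 assms(4-8) by (auto simp: shift_def split: if_splits)
      ultimately have "D w P (shift R b c) = qint (int (P d)) * (Q c ^ shift R b c c / Q d ^ shift R b c d) * D v (shift P c d) (shift R b c)
         + qint (int (shift R b c d)) * D v P (shift (shift R b c) c d)" by (rule Dw)
      moreover have "shift (shift R b c) c d = shift R b d" using assms c1 by (auto simp: shift_def)
      moreover have "D v (shift P c d) (shift R b c) = 0" by (rule D_over[where x = c]; use assms(2,4,5,9) c1 v in \<open>simp add: shift_same\<close>)
      ultimately show ?thesis using c1 assms(4-6) by (simp add: shift_other shift_same)
    qed
    have "D w' P R = (Q b ^ R b / Q c) * D w (shift P b c) R + D w P (shift R b c)"
      using Dw'[OF PR wPR] c1 by simp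
    then show ?thesis unfolding 1 2 by simp
  qed
  then show "\<exists>w\<in>S. homog (shift \<nu> d b) w \<and>
     (\<forall>P R. (P, R) \<in> B \<longrightarrow> (\<forall>i. P i + R i = shift \<nu> d b i) \<longrightarrow>
       D w P R = qint (int (P d)) * (Q b ^ R b / Q d ^ R d) * D v (shift P b d) R
         + qint (int (R d)) * D v P (shift R b d))"
    using w' by blast
qed

end

subsection \<open>Two-term relations\<close>

context tensor_submodule
begin

text \<open>For \<open>\<gamma> = 1\<close> and adjacent sites this says that the image under the
  generator \<open>e\<close> moving a box from \<open>j\<close> to \<open>z\<close> vanishes,
  compare \<open>coord_TE\<close>. For distant sites no operator is attached to it;
  \<open>\<gamma>\<close> records what elimination has accumulated.\<close>

definition kills :: "(idx2 \<Rightarrow> K) \<Rightarrow> (nat \<Rightarrow> nat) \<Rightarrow> nat \<Rightarrow> nat \<Rightarrow> K \<Rightarrow> bool" where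
  "kills v \<nu> z j \<gamma> \<longleftrightarrow> (\<forall>P R. (P, R) \<in> B \<longrightarrow> (\<forall>i. P i + R i = shift \<nu> z j i) \<longrightarrow>
     qint (int (P z)) * D v (shift P j z) R
       + \<gamma> * (Q j ^ P j / Q z ^ P z) * qint (int (R z)) * D v P (shift R j z) = 0)"

lemma killsD:
  assumes "kills v \<nu> z j \<gamma>" "(P, R) \<in> B" "\<And>i. P i + R i = shift \<nu> z j i"
  shows "qint (int (P z)) * D v (shift P j z) R
       + \<gamma> * (Q j ^ P j / Q z ^ P z) * qint (int (R z)) * D v P (shift R j z) = 0"
  using assms unfolding kills_def by blast

text \<open>The single box at \<open>c\<close> lies in one of the two factors. In either case the
  two given relations share one coefficient, in which a box goes from \<open>c\<close> to
  \<open>z\<close> in one factor and another from \<open>d\<close> to \<open>c\<close> in the other.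
  Eliminating it costs the factor -1/\<open>Q c\<close>, which is q because \<open>c\<close> is
  odd.\<close>

lemma kills_trans:
  assumes v: "v \<in> S" and sites: "z \<in> {1..n}" "c \<in> {1..n}" "d \<in> {1..n}" "z \<noteq> c" "c \<noteq> d" "z \<noteq> d"
    and c: "eps c = 1" "\<nu> c = 1" and d: "\<nu> d \<ge> 1"
    and zc: "kills v \<nu> z c \<gamma>" and cd: "kills v \<nu> c d 1"
  shows "kills v \<nu> z d (\<gamma> * qq)"
  unfolding kills_def
proof (intro allI impI)
  fix P R assume PR: "(P, R) \<in> B" and "\<forall>i. P i + R i = shift \<nu> z d i"
  then have wt: "\<And>i. P i + R i = shift \<nu> z d i" by blast
  have Qc: "inverse (Q c) = - qq" using c by (simp add: qj_def)
  have "P c + R c = 1" using wt[of c] sites c by (simp add: shift_other)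
  then consider "P c = 0" "R c = 1" | "P c = 1" "R c = 0" by linarith
  then show "qint (int (P z)) * D v (shift P d z) R
       + \<gamma> * qq * (Q d ^ P d / Q z ^ P z) * qint (int (R z)) * D v P (shift R d z) = 0"
  proof cases
    case 1
    have E1: "qint (int (P z)) * D v (shift P d z) R
        = qint (int (P z)) * (Q d ^ P d * qq * D v (shift P c z) (shift R d c))"
    proof (cases "P z \<ge> 1")
      case True
      have "(shift P c z, R) \<in> B" by (rule shift_TBasis[OF PR]) (use sites True 1 in auto)
      moreover have "shift P c z i + R i = shift \<nu> c d i" for i
        using wt[of i] wt[of z] sites True 1 c by (auto simp: shift_def split: if_splits)
      ultimately have "qint (int (shift P c z c)) * D v (shift (shift P c z) d c) R
          + 1 * (Q d ^ shift P c z d / Q c ^ shift P c z c) * qint (int (R c))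
            * D v (shift P c z) (shift R d c) = 0"
        by (rule killsD[OF cd])
      moreover have "shift (shift P c z) d c = shift P d z" using sites 1 by (auto simp: shift_def)
      ultimately have "D v (shift P d z) R
          + (Q d ^ P d * inverse (Q c)) * D v (shift P c z) (shift R d c) = 0"
        using sites 1 by (simp add: shift_same shift_other divide_inverse)
      then show ?thesis unfolding Qc by (simp add: algebra_simps)
    next
      case False
      then have "P z = 0" by simp
      then show ?thesis by simp
    qed
    have E2: "qint (int (P z)) * D v (shift P c z) (shift R d c)
        + \<gamma> * (1 / Q z ^ P z) * qint (int (R z)) * D v P (shift R d z) = 0"
    proof (cases "eps d = 1 \<and> R d \<ge> 1")
      case True
      have "D v (shift P c z) (shift R d c) = 0" "D v P (shift R d z) = 0"
        by (rule D_over[where x = d]; use v sites True in \<open>simp add: shift_same\<close>)+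
      then show ?thesis by simp
    next
      case False
      have "(P, shift R d c) \<in> B" by (rule shift_TBasis[OF PR]) (use sites False 1 in auto)
      moreover have "P i + shift R d c i = shift \<nu> z c i" for i
        using wt[of i] sites d 1 c by (auto simp: shift_def split: if_splits)
      ultimately have "qint (int (P z)) * D v (shift P c z) (shift R d c)
          + \<gamma> * (Q c ^ P c / Q z ^ P z) * qint (int (shift R d c z))
            * D v P (shift (shift R d c) c z) = 0"
        by (rule killsD[OF zc])
      moreover have "shift (shift R d c) c z = shift R d z" using sites 1 by (auto simp: shift_def)
      ultimately show ?thesis using sites 1 by (simp add: shift_same shift_other)
    qed
    have "qint (int (P z)) * D v (shift P d z) R
        + \<gamma> * qq * (Q d ^ P d / Q z ^ P z) * qint (int (R z)) * D v P (shift R d z)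
      = Q d ^ P d * qq * (qint (int (P z)) * D v (shift P c z) (shift R d c)
        + \<gamma> * (1 / Q z ^ P z) * qint (int (R z)) * D v P (shift R d z))"
      unfolding E1 by (simp add: algebra_simps)
    then show ?thesis unfolding E2 by simp
  next
    case 2
    have E1: "qint (int (R z)) * D v (shift P d c) (shift R c z)
        = qint (int (R z)) * (Q d ^ P d * qq * D v P (shift R d z))"
    proof (cases "R z \<ge> 1")
      case True
      have "(P, shift R c z) \<in> B" by (rule shift_TBasis[OF PR]) (use sites True 2 in auto)
      moreover have "P i + shift R c z i = shift \<nu> c d i" for i
        using wt[of i] wt[of z] sites True 2 c by (auto simp: shift_def split: if_splits)
      ultimately have "qint (int (P c)) * D v (shift P d c) (shift R c z)
          + 1 * (Q d ^ P d / Q c ^ P c) * qint (int (shift R c z c))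
            * D v P (shift (shift R c z) d c) = 0"
        by (rule killsD[OF cd])
      moreover have "shift (shift R c z) d c = shift R d z" using sites 2 by (auto simp: shift_def)
      ultimately have "D v (shift P d c) (shift R c z)
          + (Q d ^ P d * inverse (Q c)) * D v P (shift R d z) = 0"
        using sites 2 by (simp add: shift_same shift_other divide_inverse)
      then show ?thesis unfolding Qc by (simp add: algebra_simps)
    next
      case False
      then have "R z = 0" by simp
      then show ?thesis by simp
    qed
    have E2: "qint (int (P z)) * D v (shift P d z) R
        + \<gamma> * (1 / Q z ^ P z) * (qint (int (R z)) * D v (shift P d c) (shift R c z)) = 0"
    proof (cases "eps d = 1 \<and> P d \<ge> 1")
      case True
      have "D v (shift P d z) R = 0" "D v (shift P d c) (shift R c z) = 0"
        by (rule D_over[where x = d]; use v sites True in \<open>simp add: shift_same\<close>)+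
      then show ?thesis by simp
    next
      case False
      have "(shift P d c, R) \<in> B" by (rule shift_TBasis[OF PR]) (use sites False 2 in auto)
      moreover have "shift P d c i + R i = shift \<nu> z c i" for i
        using wt[of i] sites d 2 c by (auto simp: shift_def split: if_splits)
      ultimately have "qint (int (shift P d c z)) * D v (shift (shift P d c) c z) R
          + \<gamma> * (Q c ^ shift P d c c / Q z ^ shift P d c z) * qint (int (R z))
            * D v (shift P d c) (shift R c z) = 0"
        by (rule killsD[OF zc])
      moreover have "shift (shift P d c) c z = shift P d z" using sites 2 by (auto simp: shift_def)
      ultimately show ?thesis using sites 2 by (simp add: shift_same shift_other)
    qed
    show ?thesis using E2 unfolding E1 by (simp add: algebra_simps)
  qed
qed

text \<open>Transporting a box from \<open>b\<close> to \<open>z\<close> along the two arcs of the circle gives two linear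
  relations between the same pair of coefficients; they are compatible only if the weights match.\<close>

lemma two_arcs:
  assumes v: "v \<in> S" "homog \<nu> v" and sites: "z \<in> {1..n}" "b \<in> {1..n}" "z \<noteq> b"
    and kill: "kills v \<nu> z b \<gamma>"
    and close: "\<And>P R. (P, R) \<in> B \<Longrightarrow> (\<And>i. P i + R i = shift \<nu> z b i) \<Longrightarrow>
        qint (int (P z)) * (Q b ^ R b / Q z ^ R z) * D v (shift P b z) R
        + qint (int (R z)) * D v P (shift R b z) = 0"
    and pr: "D v p r \<noteq> 0"
    and free: "p b \<ge> 1 \<and> (eps z = 1 \<longrightarrow> p z = 0) \<or> r b \<ge> 1 \<and> (eps z = 1 \<longrightarrow> r z = 0)"
  shows "\<gamma> * Q b ^ (\<nu> b - 1) = Q z ^ (\<nu> z + 1)"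
proof -
  have prB: "(p, r) \<in> B" using pr D_off[OF v(1)] by blast
  have wpr: "p i + r i = \<nu> i" for i using D_homog[OF v(2) pr] .
  \<comment> \<open>\<open>free\<close> permits moving a box from \<open>b\<close> to
    \<open>z\<close> within one factor of \<open>(p, r)\<close>; at the resulting pair the given
    nonzero coefficient is one of the two that are compared.\<close>
  have "\<exists>P R. (P, R) \<in> B \<and> (\<forall>i. P i + R i = shift \<nu> z b i)
      \<and> (qint (int (P z)) * D v (shift P b z) R \<noteq> 0 \<or> qint (int (R z)) * D v P (shift R b z) \<noteq> 0)"
    using free
  proof
    assume h: "p b \<ge> 1 \<and> (eps z = 1 \<longrightarrow> p z = 0)"
    have "(shift p z b, r) \<in> B" by (rule shift_TBasis[OF prB]) (use h sites in auto)
    moreover have "shift p z b i + r i = shift \<nu> z b i" for i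
      using wpr[of i] h by (auto simp: shift_def)
    moreover have "qint (int (shift p z b z)) * D v (shift (shift p z b) b z) r \<noteq> 0"
      using h sites pr by (simp add: shift_shift shift_same qint_nz del: of_nat_Suc)
    ultimately show ?thesis by blast
  next
    assume h: "r b \<ge> 1 \<and> (eps z = 1 \<longrightarrow> r z = 0)"
    have "(p, shift r z b) \<in> B" by (rule shift_TBasis[OF prB]) (use h sites in auto)
    moreover have "p i + shift r z b i = shift \<nu> z b i" for i
      using wpr[of i] h by (auto simp: shift_def)
    moreover have "qint (int (shift r z b z)) * D v p (shift (shift r z b) b z) \<noteq> 0"
      using h sites pr by (simp add: shift_shift shift_same qint_nz del: of_nat_Suc)
    ultimately show ?thesis by blast
  qed
  then obtain P R where PR: "(P, R) \<in> B" and wt: "\<And>i. P i + R i = shift \<nu> z b i"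
    and nz: "qint (int (P z)) * D v (shift P b z) R \<noteq> 0 \<or> qint (int (R z)) * D v P (shift R b z) \<noteq> 0"
    by blast
  define X where "X = qint (int (P z)) * D v (shift P b z) R"
  define Y where "Y = qint (int (R z)) * D v P (shift R b z)"
  have 1: "X + \<gamma> * (Q b ^ P b / Q z ^ P z) * Y = 0"
    using killsD[OF kill PR wt] by (simp add: X_def Y_def ac_simps)
  have 2: "Q b ^ R b / Q z ^ R z * X + Y = 0"
    using close[OF PR wt] by (simp add: X_def Y_def ac_simps)
  have "Y = - (Q b ^ R b / Q z ^ R z * X)" using 2 by (simp add: eq_neg_iff_add_eq_0 add.commute)
  then have "X \<noteq> 0" and "X * (1 - \<gamma> * (Q b ^ P b / Q z ^ P z) * (Q b ^ R b / Q z ^ R z)) = 0"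
    using nz 1 by (auto simp: X_def[symmetric] Y_def[symmetric] algebra_simps)
  \<comment> \<open>The determinant of the 2 by 2 system vanishes; the exponents from the two
    factors then add up to total occupations.\<close>
  then have "\<gamma> * (Q b ^ P b / Q z ^ P z) * (Q b ^ R b / Q z ^ R z) = 1"
    by (metis mult_eq_0_iff right_minus_eq)
  then have "\<gamma> * Q b ^ (P b + R b) = Q z ^ (P z + R z)"
    by (simp add: power_add field_simps)
  moreover have "P b + R b = \<nu> b - 1" "P z + R z = \<nu> z + 1"
    using wt[of b] wt[of z] sites by (auto simp: shift_same)
  ultimately show ?thesis by simp
qed

end

subsection \<open>Extremal weight vectors\<close>

lemma sum_weighted_shift:
  fixes u c :: "nat \<Rightarrow> nat"
  assumes "inj_on u {..<n}" "a < n" "b < n" "a \<noteq> b" "P (u b) \<ge> 1"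
  shows "(\<Sum>j<n. c j * shift P (u a) (u b) (u j)) + c b = (\<Sum>j<n. c j * P (u j)) + c a"
proof -
  have ab: "u a \<noteq> u b" using assms by (auto dest: inj_onD)
  have s: "sum f {..<n} = f a + (f b + sum f ({..<n} - {a} - {b}))" for f :: "nat \<Rightarrow> nat"
    using assms by (subst sum.remove[of _ a]; simp) (subst sum.remove[of _ b]; simp)
  have eq: "(\<Sum>j\<in>{..<n} - {a} - {b}. c j * shift P (u a) (u b) (u j)) = (\<Sum>j\<in>{..<n} - {a} - {b}. c j * P (u j))"
  proof (rule sum.cong)
    fix j assume "j \<in> {..<n} - {a} - {b}"
    then have "u j \<noteq> u a" "u j \<noteq> u b" using assms(1-3) by (auto dest: inj_onD)
    then show "c j * shift P (u a) (u b) (u j) = c j * P (u j)" by (simp add: shift_other)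
  qed simp
  obtain k where k: "P (u b) = Suc k" using assms(5) by (cases "P (u b)") auto
  show ?thesis by (subst (1 2) s) (use ab eq k in \<open>simp add: shift_same algebra_simps\<close>)
qed

text \<open>The circle is cut open before \<open>u 0\<close>, and moving forward means towards
  smaller indices. The value \<open>u n = u 0\<close> lets a path leave at the end and re-enter at
  the front.\<close>

locale tensor_sites = tensor_submodule +
  fixes u :: "nat \<Rightarrow> nat"
  assumes u_bij: "bij_betw u {..<n} {1..n}"
    and u_Suc: "j < n \<Longrightarrow> cyc_succ n (u j) = u (Suc j)"
    and u_n: "u n = u 0"
begin

lemma u_inj: "inj_on u {..<n}"
  using u_bij by (rule bij_betw_imp_inj_on)

lemma u_range: "j < n \<Longrightarrow> u j \<in> {1..n}"
  using u_bij by (auto simp: bij_betw_def)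

lemma u_eq: "i < n \<Longrightarrow> j < n \<Longrightarrow> u i = u j \<longleftrightarrow> i = j"
  using u_inj by (auto dest: inj_onD)

lemma sum_sites: "(\<Sum>i\<in>{1..n}. f i) = (\<Sum>j<n. f (u j))"
  by (rule sum.reindex_bij_betw[OF u_bij, symmetric])

lemma sum_TBasis: "(P, R) \<in> B \<Longrightarrow> (\<Sum>j<n. P (u j)) = l" "(P, R) \<in> B \<Longrightarrow> (\<Sum>j<n. R (u j)) = m"
  unfolding sum_sites[symmetric] by (simp_all add: TBasis_def Wbasis_iff)

text \<open>The weights decrease along the sites, so every transfer of a box to a smaller index
  raises the height, whichever arc the box takes.\<close>

definition height :: "(nat \<Rightarrow> nat) \<Rightarrow> nat" where
  "height \<nu> = (\<Sum>j<n. (n - j) * \<nu> (u j))"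

text \<open>The maximum is taken over all weights occurring in \<open>S\<close>, so any element of
  \<open>S\<close> of larger height is zero, no matter how it was produced.\<close>

definition extremal :: "(idx2 \<Rightarrow> K) \<Rightarrow> (nat \<Rightarrow> nat) \<Rightarrow> bool" where
  "extremal v \<nu> \<longleftrightarrow> v \<in> S \<and> v \<noteq> (\<lambda>p. 0) \<and> homog \<nu> v \<and>
     (\<forall>w\<in>S. \<forall>\<nu>'. w \<noteq> (\<lambda>p. 0) \<longrightarrow> homog \<nu>' w \<longrightarrow> height \<nu>' \<le> height \<nu>)"

lemma D_nonzero:
  assumes "v \<noteq> (\<lambda>p. 0)"
  obtains P R where "D v P R \<noteq> 0"
  using assms by (auto simp: coord_def fun_eq_iff)

lemma homog_TBasis:
  assumes "v \<in> S" "v \<noteq> (\<lambda>p. 0)" "homog \<nu> v"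
  obtains P R where "(P, R) \<in> B" "\<And>i. P i + R i = \<nu> i" "D v P R \<noteq> 0"
proof -
  obtain P R where "D v P R \<noteq> 0" using D_nonzero[OF assms(2)] .
  then have "(P, R) \<in> B" "\<And>i. P i + R i = \<nu> i"
    using D_off[OF assms(1)] D_homog[OF assms(3)] by blast+
  then show ?thesis using \<open>D v P R \<noteq> 0\<close> by (rule that)
qed

lemma height_bound:
  assumes "v \<in> S" "v \<noteq> (\<lambda>p. 0)" "homog \<nu> v"
  shows "height \<nu> \<le> n * (l + m)"
proof -
  obtain P R where PR: "(P, R) \<in> B" "\<And>i. P i + R i = \<nu> i" using homog_TBasis[OF assms] by blast
  have "height \<nu> \<le> (\<Sum>j<n. n * \<nu> (u j))" unfolding height_def by (intro sum_mono) simp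
  also have "\<dots> = n * (\<Sum>j<n. P (u j) + R (u j))" by (simp add: sum_distrib_left PR(2))
  also have "\<dots> = n * (l + m)" using sum_TBasis[OF PR(1)] by (simp add: sum.distrib)
  finally show ?thesis .
qed

lemma extremal_exists:
  assumes "S \<noteq> {\<lambda>p. 0}"
  obtains v \<nu> where "extremal v \<nu>"
proof -
  obtain v \<nu> where v: "v \<in> S" "v \<noteq> (\<lambda>p. 0)" "homog \<nu> v" using weight_vector[OF assms] .
  let ?P = "\<lambda>(w, \<nu>'). w \<in> S \<and> w \<noteq> (\<lambda>p. 0) \<and> homog \<nu>' w"
  have "\<exists>x. ?P x \<and> (\<forall>y. ?P y \<longrightarrow> height (snd y) \<le> height (snd x))"
    by (rule ex_has_greatest_nat[where k = "(v, \<nu>)" and b = "Suc (n * (l + m))"])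
      (use v height_bound in \<open>auto simp: less_Suc_eq_le intro: le_SucI\<close>)
  then show ?thesis using that by (auto simp: extremal_def)
qed

lemma height_shift:
  assumes "z < b" "b < n" "\<nu> (u b) \<ge> 1"
  shows "height \<nu> < height (shift \<nu> (u z) (u b))"
  using sum_weighted_shift[OF u_inj, of z b \<nu> "\<lambda>j. n - j"] assms unfolding height_def by simp

lemma extremal_zero:
  assumes "extremal v \<nu>" "z < b" "b < n" "\<nu> (u b) \<ge> 1" "w \<in> S" "homog (shift \<nu> (u z) (u b)) w"
  shows "D w P R = 0"
proof -
  have "w = (\<lambda>p. 0)"
    using assms(1,5,6) height_shift[of z b \<nu>, OF assms(2-4)] unfolding extremal_def by (meson not_le)
  then show ?thesis by (simp add: coord_def)
qed

text \<open>The bound on \<open>j\<close> leaves out the generator at the cut: its \<open>e\<close>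
  takes a box from \<open>u 0\<close> to the last site and lowers the height. The matching
  \<open>f\<close> raises it and is used in \<open>carries_path\<close>.\<close>

lemma extremal_kills:
  assumes ex: "extremal v \<nu>" and j: "Suc j < n" "\<nu> (u (Suc j)) \<ge> 1"
  shows "kills v \<nu> (u j) (u (Suc j)) 1"
proof -
  have v: "v \<in> S" "homog \<nu> v" using ex by (auto simp: extremal_def)
  let ?w = "act B (TE n eps 1 1 (u j mod n)) v"
  have uj: "u j \<in> {1..n}" using j u_range by simp
  have wS: "?w \<in> S" by (rule S_TE[OF v(1) uj])
  have s: "u (Suc j) = cyc_succ n (u j)" using u_Suc j by simp
  note D = coord_TE[OF n2 uj _ S_vspace[OF v(1)] s]
  have "homog (shift \<nu> (u j) (u (Suc j))) ?w"
    by (rule homog_shift[where v = v and x = "\<lambda>P R. 1"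
          and y = "\<lambda>P R. Q (u (Suc j)) ^ P (u (Suc j)) / Q (u j) ^ P (u j)"])
      (use j v wS u_eq[of "Suc j" j] in \<open>simp_all add: D\<close>)
  then have 0: "D ?w P R = 0" for P R by (rule extremal_zero[OF ex lessI j wS])
  show ?thesis
    unfolding kills_def
  proof (intro allI impI)
    fix P R assume "(P, R) \<in> B"
    from D[OF this] show "qint (int (P (u j))) * D v (shift P (u (Suc j)) (u j)) R
       + 1 * (Q (u (Suc j)) ^ P (u (Suc j)) / Q (u j) ^ P (u j)) * qint (int (R (u j)))
         * D v P (shift R (u (Suc j)) (u j)) = 0" unfolding 0 by simp
  qed
qed

section \<open>Both arcs between \<open>u z\<close> and \<open>u b\<close>\<close>

lemma carries_empty_path:
  assumes "1 \<le> b" "Suc b \<le> k" "k \<le> n" "\<nu> (u b) \<ge> 1" "\<And>j. b < j \<Longrightarrow> j < n \<Longrightarrow> \<nu> (u j) = 0"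
  shows "carries \<nu> (u b) (u k)"
  using assms(2,3)
proof (induction k rule: dec_induct)
  case base
  then show ?case using carries_succ[of "u b" \<nu>] u_Suc[of b] u_range[of b] assms by simp
next
  case (step k)
  have k: "k < n" "b < n" "b < k" "1 \<le> k" using step.hyps step.prems assms(1) by auto
  have ub: "u (Suc k) \<in> {1..n} \<and> u b \<noteq> u (Suc k) \<and> u k \<noteq> u (Suc k)"
  proof (cases "Suc k = n")
    case True
    then have "u (Suc k) = u 0" using u_n by simp
    then show ?thesis using k assms(1) u_range[of 0] u_eq[of b 0] u_eq[of k 0] by simp
  next
    case False
    then have "Suc k < n" using k by simp
    then show ?thesis using k u_range[of "Suc k"] u_eq[of b "Suc k"] u_eq[of k "Suc k"] by simp
  qed
  have bk: "u b \<noteq> u k" using k u_eq[of b k] by simp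
  show ?case
  proof (rule carries_empty[where c = "u k" and b = "u b"])
    show "carries \<nu> (u b) (u k)" using step.IH k by simp
    show "carries (shift \<nu> (u k) (u b)) (u k) (u (Suc k))"
      using carries_succ[of "u k" "shift \<nu> (u k) (u b)"] u_range[OF k(1)] u_Suc[OF k(1)] bk
      by (simp add: shift_same)
    show "\<nu> (u k) = 0" by (rule assms(5)) (use k in auto)
  qed (use k ub bk assms(4) u_range in auto)
qed

lemma carries_full_path:
  assumes "z < n" "\<And>j. j < z \<Longrightarrow> \<nu> (u j) = 2 \<and> eps (u j) = 1" "i < z"
  shows "carries \<nu> (u i) (u z)"
proof -
  have "i \<le> z - 1" using assms by simp
  then show ?thesis
  proof (induction i rule: inc_induct)
    case base
    show ?case using carries_succ[of "u (z - 1)" \<nu>] u_Suc[of "z - 1"] u_range[of "z - 1"] assms by simp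
  next
    case (step i)
    have i: "i < n" "Suc i < n" "Suc i < z" "i < z" using step assms by auto
    have ne: "u i \<noteq> u (Suc i)" "u i \<noteq> u z" "u (Suc i) \<noteq> u z"
      using i assms(1) u_eq[of i "Suc i"] u_eq[of i z] u_eq[of "Suc i" z] by auto
    show ?case
    proof (rule carries_full[where c = "u (Suc i)" and b = "u i"])
      show "carries \<nu> (u (Suc i)) (u z)" by (rule step.IH)
      show "carries (shift \<nu> (u z) (u (Suc i))) (u i) (u (Suc i))"
        using carries_succ[of "u i" "shift \<nu> (u z) (u (Suc i))"] u_range[OF i(1)] u_Suc[OF i(1)]
          ne assms(2)[OF i(4)] by (simp add: shift_other)
    qed (use i ne assms(1) assms(2)[OF i(3)] assms(2)[OF i(4)] u_range in auto)
  qed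
qed

text \<open>The box at \<open>u 0\<close> goes to \<open>u z\<close> first, through the full sites,
  and then the last box crosses the cut and replaces it. The second transport therefore starts from
  the weight \<open>shift \<nu> (u z) (u 0)\<close>, where the sites behind \<open>u b\<close> are
  still empty.\<close>

lemma carries_path:
  assumes "z < b" "b < n" "\<nu> (u b) \<ge> 1"
    and empty: "\<And>j. b < j \<Longrightarrow> j < n \<Longrightarrow> \<nu> (u j) = 0"
    and full: "\<And>j. j < z \<Longrightarrow> \<nu> (u j) = 2 \<and> eps (u j) = 1"
  shows "carries \<nu> (u b) (u z)"
proof (cases "z = 0")
  case True
  then show ?thesis using carries_empty_path[of b n \<nu>] assms u_n by simp
next
  case False
  let ?\<nu> = "shift \<nu> (u z) (u 0)"
  have z: "z < n" "0 < n" using assms by auto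
  have o: "?\<nu> (u j) = \<nu> (u j)" if "j < n" "z < j" for j
    using that u_eq[of j z] u_eq[of j 0] z by (simp add: shift_other)
  have "carries ?\<nu> (u b) (u n)"
  proof (rule carries_empty_path)
    show "?\<nu> (u b) \<ge> 1" using o[of b] assms(1-3) by simp
    show "?\<nu> (u j) = 0" if "b < j" "j < n" for j using o[of j] empty[of j] that assms(1) by simp
  qed (use assms(1,2) in auto)
  then have b0: "carries ?\<nu> (u b) (u 0)" by (simp only: u_n)
  have 0: "carries \<nu> (u 0) (u z)" using carries_full_path[OF z(1) full, where i = 0] False by simp
  have ne: "u b \<noteq> u 0" "u 0 \<noteq> u z" "u b \<noteq> u z"
    using assms(1,2) z False u_eq[of b 0] u_eq[of 0 z] u_eq[of b z] by auto
  show ?thesis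
    by (rule carries_full[OF _ _ _ ne(1,2,3) _ _ _ 0 b0])
      (use assms(2,3) z False u_range full[of 0] in auto)
qed

lemma kills_chain:
  assumes ex: "extremal v \<nu>" and "Suc z \<le> k" "k < n" "\<nu> (u k) \<ge> 1"
    and mid: "\<And>j. z < j \<Longrightarrow> j < k \<Longrightarrow> \<nu> (u j) = 1 \<and> eps (u j) = 1"
  shows "kills v \<nu> (u z) (u k) (qq ^ (k - z - 1))"
  using assms(2-5)
proof (induction k rule: dec_induct)
  case base
  then show ?case using extremal_kills[OF ex, of z] by simp
next
  case (step k)
  have k: "k < n" "z < k" "\<nu> (u k) = 1" "eps (u k) = 1" using step by auto
  have "kills v \<nu> (u z) (u k) (qq ^ (k - z - 1))" using step k by simp
  moreover have "kills v \<nu> (u k) (u (Suc k)) 1" using extremal_kills[OF ex] step by simp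
  moreover have "u z \<noteq> u k" "u k \<noteq> u (Suc k)" "u z \<noteq> u (Suc k)"
    using k step.prems(1) u_eq[of z k] u_eq[of z "Suc k"] u_eq[of k "Suc k"] by auto
  moreover have "v \<in> S" using ex by (simp add: extremal_def)
  ultimately have "kills v \<nu> (u z) (u (Suc k)) (qq ^ (k - z - 1) * qq)"
    using k step.prems(1,2) u_range[of z] u_range[of k] u_range[of "Suc k"]
    by (intro kills_trans[where c = "u k"]) simp_all
  moreover have "qq ^ (k - z - 1) * qq = qq ^ (Suc k - z - 1)"
  proof -
    have "Suc k - z - 1 = Suc (k - z - 1)" using k by simp
    then show ?thesis by (simp only: power_Suc2)
  qed
  ultimately show ?case by simp
qed

text \<open>\<open>mid\<close> serves the arc inside the interval, where each intermediate site
  contributes a factor q; \<open>empty\<close> and \<open>full\<close> serve the arc through the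
  cut.\<close>

lemma extremal_ratio:
  assumes ex: "extremal v \<nu>" and zb: "z < b" "b < n" "\<nu> (u b) \<ge> 1"
    and empty: "\<And>j. b < j \<Longrightarrow> j < n \<Longrightarrow> \<nu> (u j) = 0"
    and mid: "\<And>j. z < j \<Longrightarrow> j < b \<Longrightarrow> \<nu> (u j) = 1 \<and> eps (u j) = 1"
    and full: "\<And>j. j < z \<Longrightarrow> \<nu> (u j) = 2 \<and> eps (u j) = 1"
    and pr: "D v p r \<noteq> 0"
    and free: "p (u b) \<ge> 1 \<and> (eps (u z) = 1 \<longrightarrow> p (u z) = 0)
      \<or> r (u b) \<ge> 1 \<and> (eps (u z) = 1 \<longrightarrow> r (u z) = 0)"
  shows "qq ^ (b - z - 1) * Q (u b) ^ (\<nu> (u b) - 1) = Q (u z) ^ (\<nu> (u z) + 1)"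
proof (rule two_arcs[OF _ _ _ _ _ _ _ pr free])
  show v: "v \<in> S" "homog \<nu> v" using ex by (auto simp: extremal_def)
  show "u z \<in> {1..n}" "u b \<in> {1..n}" "u z \<noteq> u b" using zb u_range u_eq[of z b] by auto
  show "kills v \<nu> (u z) (u b) (qq ^ (b - z - 1))" using kills_chain[OF ex] zb mid by simp
  obtain w where w: "w \<in> S" "homog (shift \<nu> (u z) (u b)) w" and
    Dw: "\<And>P R. (P, R) \<in> B \<Longrightarrow> (\<And>i. P i + R i = shift \<nu> (u z) (u b) i) \<Longrightarrow>
       D w P R = qint (int (P (u z))) * (Q (u b) ^ R (u b) / Q (u z) ^ R (u z)) * D v (shift P (u b) (u z)) R
         + qint (int (R (u z))) * D v P (shift R (u b) (u z))"
    using carriesE[OF carries_path[OF zb empty full] v] by blast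
  show "qint (int (P (u z))) * (Q (u b) ^ R (u b) / Q (u z) ^ R (u z)) * D v (shift P (u b) (u z)) R
         + qint (int (R (u z))) * D v P (shift R (u b) (u z)) = 0"
    if "(P, R) \<in> B" "\<And>i. P i + R i = shift \<nu> (u z) (u b) i" for P R
    using Dw[OF that] extremal_zero[OF ex zb w] by simp
qed

section \<open>Exchange moves in the support of an extremal vector\<close>

text \<open>A relation with two terms cannot have exactly one nonzero term. So a possible forward
  move in the first factor forces the partner coefficient, where the second factor moves a box
  backward, to be nonzero too.\<close>

lemma extremal_move_fst:
  assumes ex: "extremal v \<nu>" and j: "Suc j < n" and pr: "D v p r \<noteq> 0"
    and p: "p (u (Suc j)) \<ge> 1" "eps (u j) = 1 \<Longrightarrow> p (u j) = 0"
  shows "r (u j) \<ge> 1" "D v (shift p (u j) (u (Suc j))) (shift r (u (Suc j)) (u j)) \<noteq> 0"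
proof -
  have v: "v \<in> S" "homog \<nu> v" using ex by (auto simp: extremal_def)
  have prB: "(p, r) \<in> B" using pr D_off[OF v(1)] by blast
  have wpr: "p i + r i = \<nu> i" for i using D_homog[OF v(2) pr] .
  have s: "u j \<in> {1..n}" "u (Suc j) \<in> {1..n}" "u j \<noteq> u (Suc j)" using j u_range u_eq[of j "Suc j"] by auto
  let ?P = "shift p (u j) (u (Suc j))"
  have "(?P, r) \<in> B" by (rule shift_TBasis[OF prB]) (use s p in auto)
  moreover have "?P i + r i = shift \<nu> (u j) (u (Suc j)) i" for i
    using wpr[of i] p by (auto simp: shift_def)
  moreover have "kills v \<nu> (u j) (u (Suc j)) 1"
    using extremal_kills[OF ex j] wpr[of "u (Suc j)"] p by simp
  ultimately have "qint (int (?P (u j))) * D v (shift ?P (u (Suc j)) (u j)) r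
       + 1 * (Q (u (Suc j)) ^ ?P (u (Suc j)) / Q (u j) ^ ?P (u j)) * qint (int (r (u j)))
         * D v ?P (shift r (u (Suc j)) (u j)) = 0" by (intro killsD)
  moreover have "qint (int (?P (u j))) * D v (shift ?P (u (Suc j)) (u j)) r \<noteq> 0"
    using s p pr by (simp add: shift_shift shift_same qint_nz del: of_nat_Suc)
  ultimately have h: "qint (int (r (u j))) \<noteq> 0" "D v ?P (shift r (u (Suc j)) (u j)) \<noteq> 0" by auto
  from h(1) show "r (u j) \<ge> 1" by (cases "r (u j)") auto
  from h(2) show "D v ?P (shift r (u (Suc j)) (u j)) \<noteq> 0" .
qed

lemma extremal_move_snd:
  assumes ex: "extremal v \<nu>" and j: "Suc j < n" and pr: "D v p r \<noteq> 0"
    and r: "r (u (Suc j)) \<ge> 1" "eps (u j) = 1 \<Longrightarrow> r (u j) = 0"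
  shows "p (u j) \<ge> 1" "D v (shift p (u (Suc j)) (u j)) (shift r (u j) (u (Suc j))) \<noteq> 0"
proof -
  have v: "v \<in> S" "homog \<nu> v" using ex by (auto simp: extremal_def)
  have prB: "(p, r) \<in> B" using pr D_off[OF v(1)] by blast
  have wpr: "p i + r i = \<nu> i" for i using D_homog[OF v(2) pr] .
  have s: "u j \<in> {1..n}" "u (Suc j) \<in> {1..n}" "u j \<noteq> u (Suc j)" using j u_range u_eq[of j "Suc j"] by auto
  let ?R = "shift r (u j) (u (Suc j))"
  have "(p, ?R) \<in> B" by (rule shift_TBasis[OF prB]) (use s r in auto)
  moreover have "p i + ?R i = shift \<nu> (u j) (u (Suc j)) i" for i
    using wpr[of i] r by (auto simp: shift_def)
  moreover have "kills v \<nu> (u j) (u (Suc j)) 1"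
    using extremal_kills[OF ex j] wpr[of "u (Suc j)"] r by simp
  ultimately have "qint (int (p (u j))) * D v (shift p (u (Suc j)) (u j)) ?R
       + 1 * (Q (u (Suc j)) ^ p (u (Suc j)) / Q (u j) ^ p (u j)) * qint (int (?R (u j)))
         * D v p (shift ?R (u (Suc j)) (u j)) = 0" by (intro killsD)
  moreover have "qint (int (?R (u j))) * D v p (shift ?R (u (Suc j)) (u j)) \<noteq> 0"
    using s r pr by (simp add: shift_shift shift_same qint_nz del: of_nat_Suc)
  ultimately have h: "qint (int (p (u j))) \<noteq> 0" "D v (shift p (u (Suc j)) (u j)) ?R \<noteq> 0" by auto
  from h(1) show "p (u j) \<ge> 1" by (cases "p (u j)") auto
  from h(2) show "D v (shift p (u (Suc j)) (u j)) ?R \<noteq> 0" .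
qed

text \<open>In a support element that minimises the sum of the positions of the boxes of
  \<open>p\<close>, no exchange can move a box of \<open>p\<close> forward, so each box sits
  directly behind an occupied odd site.\<close>

lemma extremal_packed_fst:
  assumes ex: "extremal v \<nu>"
  obtains p r where "D v p r \<noteq> 0"
    "\<And>j. Suc j < n \<Longrightarrow> p (u (Suc j)) \<ge> 1 \<Longrightarrow> eps (u j) = 1 \<and> p (u j) = 1"
proof -
  have v: "v \<in> S" "v \<noteq> (\<lambda>p. 0)" using ex by (auto simp: extremal_def)
  obtain P R where "D v P R \<noteq> 0" using D_nonzero[OF v(2)] .
  from ex_has_least_nat[where P = "\<lambda>(p, r). D v p r \<noteq> 0" and m = "\<lambda>x. \<Sum>j<n. j * fst x (u j)", of "(P, R)"] this
  obtain p r where pr: "D v p r \<noteq> 0"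
    and min: "\<And>p' r'. D v p' r' \<noteq> 0 \<Longrightarrow> (\<Sum>j<n. j * p (u j)) \<le> (\<Sum>j<n. j * p' (u j))" by auto
  have "eps (u j) = 1 \<and> p (u j) = 1" if j: "Suc j < n" "p (u (Suc j)) \<ge> 1" for j
  proof (rule ccontr)
    assume h: "\<not> (eps (u j) = 1 \<and> p (u j) = 1)"
    have "(p, r) \<in> B" using pr D_off[OF v(1)] by blast
    then have "eps (u j) = 1 \<Longrightarrow> p (u j) \<le> 1" using TBasis_odd u_range j by simp
    then have "eps (u j) = 1 \<Longrightarrow> p (u j) = 0" using h by linarith
    from min[OF extremal_move_fst(2)[OF ex j(1) pr j(2) this]]
      sum_weighted_shift[OF u_inj, of j "Suc j" p "\<lambda>j. j"] j
    show False by simp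
  qed
  then show ?thesis using that pr by blast
qed

lemma extremal_packed_snd:
  assumes ex: "extremal v \<nu>"
  obtains p r where "D v p r \<noteq> 0"
    "\<And>j. Suc j < n \<Longrightarrow> r (u (Suc j)) \<ge> 1 \<Longrightarrow> eps (u j) = 1 \<and> r (u j) = 1"
proof -
  have v: "v \<in> S" "v \<noteq> (\<lambda>p. 0)" using ex by (auto simp: extremal_def)
  obtain P R where "D v P R \<noteq> 0" using D_nonzero[OF v(2)] .
  from ex_has_least_nat[where P = "\<lambda>(p, r). D v p r \<noteq> 0" and m = "\<lambda>x. \<Sum>j<n. j * snd x (u j)", of "(P, R)"] this
  obtain p r where pr: "D v p r \<noteq> 0"
    and min: "\<And>p' r'. D v p' r' \<noteq> 0 \<Longrightarrow> (\<Sum>j<n. j * r (u j)) \<le> (\<Sum>j<n. j * r' (u j))" by auto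
  have "eps (u j) = 1 \<and> r (u j) = 1" if j: "Suc j < n" "r (u (Suc j)) \<ge> 1" for j
  proof (rule ccontr)
    assume h: "\<not> (eps (u j) = 1 \<and> r (u j) = 1)"
    have "(p, r) \<in> B" using pr D_off[OF v(1)] by blast
    then have "eps (u j) = 1 \<Longrightarrow> r (u j) \<le> 1" using TBasis_odd u_range j by simp
    then have "eps (u j) = 1 \<Longrightarrow> r (u j) = 0" using h by linarith
    from min[OF extremal_move_snd(2)[OF ex j(1) pr j(2) this]]
      sum_weighted_shift[OF u_inj, of j "Suc j" r "\<lambda>j. j"] j
    show False by simp
  qed
  then show ?thesis using that pr by blast
qed

end

subsection \<open>The extremal weight\<close>

definition unit_at :: "idx2 \<Rightarrow> idx2 \<Rightarrow> K" where
  "unit_at p = (\<lambda>x. if x = p then 1 else 0)"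

lemma staircase:
  fixes f :: "nat \<Rightarrow> nat"
  assumes "\<And>j. j < n \<Longrightarrow> f j \<le> 1" "\<And>j. Suc j < n \<Longrightarrow> f (Suc j) \<ge> 1 \<Longrightarrow> f j \<ge> 1"
    and "(\<Sum>j<n. f j) = k" "j < n"
  shows "f j = (if j < k then 1 else 0)"
  using assms
proof (induction n arbitrary: j k)
  case (Suc n)
  define k' where "k' = (\<Sum>j<n. f j)"
  have k: "k = k' + f n" using Suc.prems(3) by (simp add: k'_def)
  have IH: "i < n \<Longrightarrow> f i = (if i < k' then 1 else 0)" for i
    using Suc.IH[of k' i] Suc.prems(1,2) k'_def by simp
  have "k' \<le> (\<Sum>j<n. 1)" unfolding k'_def by (rule sum_mono) (use Suc.prems(1) in simp)
  then have k'n: "k' \<le> n" by simp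
  have fn: "f n = 0 \<or> f n = 1 \<and> k' = n"
  proof (cases n)
    case 0
    then show ?thesis using Suc.prems(1)[of 0] k'n by auto
  next
    case (Suc i)
    show ?thesis
    proof (cases "f n = 0")
      case False
      then have "f n = 1" using Suc.prems(1)[of n] by simp
      moreover have "f i \<ge> 1" using Suc.prems(2)[of i] Suc \<open>f n = 1\<close> by simp
      then have "i < k'" using IH[of i] Suc by (simp split: if_splits)
      ultimately show ?thesis using k'n Suc by simp
    qed simp
  qed
  show ?case
  proof (cases "j = n")
    case True
    then show ?thesis using fn k k'n by auto
  next
    case False
    then show ?thesis using IH[of j] Suc.prems(4) fn k by auto
  qed
qed simp

context tensor_sites
begin

lemma unit_in_S:
  assumes "v \<in> S" "v \<noteq> (\<lambda>p. 0)" "\<And>P R. D v P R \<noteq> 0 \<Longrightarrow> P = P0 \<and> R = R0"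
  shows "unit_at (P0, R0) \<in> S"
proof -
  obtain P R where "D v P R \<noteq> 0" using D_nonzero[OF assms(2)] .
  then have nz: "v (P0, R0) \<noteq> 0" using assms(3)[of P R] by (auto simp: coord_def)
  have "v x = 0" if "x \<noteq> (P0, R0)" for x
    using assms(3)[of "fst x" "snd x"] that by (cases x) (auto simp: coord_def)
  then have "unit_at (P0, R0) = (\<lambda>x. inverse (v (P0, R0)) * v x)"
    using nz by (auto simp: unit_at_def)
  then show ?thesis using S_scale[OF assms(1)] by simp
qed

lemma sum_from_0:
  fixes f :: "nat \<Rightarrow> nat"
  shows "(\<Sum>j<n. f j) = f 0 + (\<Sum>j\<in>{1..<n}. f j)"
  using n2 by (subst lessThan_atLeast0, subst sum.atLeast_Suc_lessThan) auto

section \<open>Circles with an even site\<close>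

lemma packed_even:
  fixes p :: "nat \<Rightarrow> nat"
  assumes "eps (u 0) = 0" "\<And>j. Suc j < n \<Longrightarrow> p (u (Suc j)) \<ge> 1 \<Longrightarrow> eps (u j) = 1 \<and> p (u j) = 1"
    and "1 \<le> j" "j < n"
  shows "p (u j) = 0"
  using assms(3,4)
proof (induction j rule: dec_induct)
  case base
  then show ?case using assms(1) assms(2)[of 0] by (cases "p (u 1)") auto
next
  case (step j)
  then show ?case using assms(2)[of j] by (cases "p (u (Suc j))") auto
qed

text \<open>Packing either factor puts all its boxes at the even site \<open>u 0\<close>, so the
  rest of the weight is visible entirely in the other factor. With \<open>b\<close> the last
  occupied site, \<open>extremal_ratio\<close> for \<open>z = 0\<close> then contradicts a count of
  boxes.\<close>

lemma extremal_even:
  assumes ex: "extremal v \<nu>" and e0: "eps (u 0) = 0" and j: "1 \<le> j" "j < n"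
  shows "\<nu> (u j) = 0"
proof (rule ccontr)
  assume "\<nu> (u j) \<noteq> 0"
  have v: "v \<in> S" "homog \<nu> v" using ex by (auto simp: extremal_def)
  define J where "J = {j. 1 \<le> j \<and> j < n \<and> \<nu> (u j) \<noteq> 0}"
  define b where "b = Max J"
  have J: "finite J" "J \<noteq> {}" using \<open>\<nu> (u j) \<noteq> 0\<close> j by (auto simp: J_def)
  have b: "1 \<le> b" "b < n" "\<nu> (u b) \<noteq> 0" using Max_in[OF J] by (auto simp: b_def J_def)
  have after: "\<nu> (u i) = 0" if "b < i" "i < n" for i
  proof (rule ccontr)
    assume "\<nu> (u i) \<noteq> 0"
    then have "i \<in> J" using that b by (simp add: J_def)
    then have "i \<le> b" using J by (simp add: b_def)
    then show False using that by simp
  qed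
  obtain p r where pr: "D v p r \<noteq> 0"
    and pp: "\<And>j. Suc j < n \<Longrightarrow> p (u (Suc j)) \<ge> 1 \<Longrightarrow> eps (u j) = 1 \<and> p (u j) = 1"
    using extremal_packed_fst[OF ex] by blast
  obtain p' r' where pr': "D v p' r' \<noteq> 0"
    and rr: "\<And>j. Suc j < n \<Longrightarrow> r' (u (Suc j)) \<ge> 1 \<Longrightarrow> eps (u j) = 1 \<and> r' (u j) = 1"
    using extremal_packed_snd[OF ex] by blast
  have p0: "p (u i) = 0" if "1 \<le> i" "i < n" for i by (rule packed_even[OF e0 pp that])
  have r0: "r' (u i) = 0" if "1 \<le> i" "i < n" for i by (rule packed_even[OF e0 rr that])
  have B: "(p, r) \<in> B" "(p', r') \<in> B" using pr pr' D_off[OF v(1)] by blast+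
  have w: "p i + r i = \<nu> i" "p' i + r' i = \<nu> i" for i using D_homog[OF v(2)] pr pr' by blast+
  have r: "r (u i) = \<nu> (u i)" if "1 \<le> i" "i < n" for i using w(1)[of "u i"] p0[OF that] by simp
  have p': "p' (u i) = \<nu> (u i)" if "1 \<le> i" "i < n" for i using w(2)[of "u i"] r0[OF that] by simp
  \<comment> \<open>A forward move of \<open>r\<close> into \<open>u i\<close> would require a box
    of \<open>p\<close> there to exchange with. There is none, so the move must be blocked by a
    filled odd site.\<close>
  have one: "\<nu> (u i) = 1 \<and> eps (u i) = 1" if "1 \<le> i" "Suc i < n" "\<nu> (u (Suc i)) \<noteq> 0" for i
  proof -
    have "r (u (Suc i)) \<ge> 1" using r[of "Suc i"] that by simp
    moreover have "p (u i) = 0" using p0 that by simp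
    ultimately have "eps (u i) = 1 \<and> r (u i) \<noteq> 0"
      using extremal_move_snd(1)[OF ex that(2) pr] by fastforce
    moreover have "eps (u i) = 1 \<Longrightarrow> r (u i) \<le> 1" using TBasis_odd[OF B(1) u_range] that by simp
    ultimately show ?thesis using r[of i] that by simp
  qed
  have nz: "\<nu> (u i) \<noteq> 0" if "1 \<le> i" "i \<le> b" for i
    using that(2,1)
  proof (induction i rule: inc_induct)
    case base
    show ?case by (rule b(3))
  next
    case (step i)
    then show ?case using one[of i] b by simp
  qed
  have mid: "\<nu> (u i) = 1 \<and> eps (u i) = 1" if "0 < i" "i < b" for i
    using one[of i] nz[of "Suc i"] that b by simp
  \<comment> \<open>\<open>T\<close> counts the boxes away from \<open>u 0\<close>. In
    \<open>(p', r')\<close> all of them lie in the first factor, so \<open>T \<le> l\<close>; in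
    \<open>(p, r)\<close> the whole first factor sits at \<open>u 0\<close>, so
    \<open>l \<le> \<nu> (u 0)\<close>.\<close>
  define T where "T = (\<Sum>i\<in>{1..<n}. \<nu> (u i))"
  have "T = (\<Sum>i\<in>{1..<Suc b}. \<nu> (u i))"
    unfolding T_def by (rule sum.mono_neutral_right) (use b after in auto)
  also have "\<dots> = (\<Sum>i\<in>{1..<b}. \<nu> (u i)) + \<nu> (u b)" using b by (simp add: sum.op_ivl_Suc)
  also have "(\<Sum>i\<in>{1..<b}. \<nu> (u i)) = (\<Sum>i\<in>{1..<b}. 1)"
    by (rule sum.cong) (use mid in auto)
  finally have T: "T + 1 = b + \<nu> (u b)" using b by simp
  have "(\<Sum>i\<in>{1..<n}. p' (u i)) = T" unfolding T_def by (rule sum.cong) (use p' in auto)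
  then have Tl: "T \<le> l" using sum_TBasis(1)[OF B(2)] sum_from_0[of "\<lambda>i. p' (u i)"] by simp
  have rT: "(\<Sum>i\<in>{1..<n}. r (u i)) = T" unfolding T_def by (rule sum.cong) (use r in auto)
  then have m: "r (u 0) + T = m" using sum_TBasis(2)[OF B(1)] sum_from_0[of "\<lambda>i. r (u i)"] by simp
  have "(\<Sum>i\<in>{1..<n}. p (u i)) = 0" using p0 by simp
  then have "p (u 0) = l" using sum_TBasis(1)[OF B(1)] sum_from_0[of "\<lambda>i. p (u i)"] by simp
  then have \<nu>0: "\<nu> (u 0) \<ge> T" using w(1)[of "u 0"] Tl by simp
  have "qq ^ (b - 0 - 1) * Q (u b) ^ (\<nu> (u b) - 1) = Q (u 0) ^ (\<nu> (u 0) + 1)"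
    by (rule extremal_ratio[OF ex _ _ _ _ _ _ pr']) (use b after mid e0 p' in auto)
  then have eq: "qq ^ (b - 1) * Q (u b) ^ (\<nu> (u b) - 1) = qq ^ (\<nu> (u 0) + 1)"
    using e0 by (simp add: qj_def)
  \<comment> \<open>The left side equals \<open>T - 1\<close>. At an odd \<open>u b\<close> the
    occupation is 1, so its power of \<open>Q (u b)\<close> is trivial and the same equation of
    exponents results.\<close>
  have "b - 1 + (\<nu> (u b) - 1) = \<nu> (u 0) + 1"
  proof (cases "eps (u b) = 0")
    case True
    then show ?thesis using eq qq_pow_inj by (simp add: qj_def power_add[symmetric] del: power_Suc)
  next
    case False
    moreover have "eps (u b) \<in> {0, 1}" using eps01 u_range[OF b(2)] by blast
    ultimately have "eps (u b) = 1" by simp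
    then have "\<nu> (u b) = 1" using TBasis_odd(2)[OF B(1) u_range[OF b(2)]] r[of b] b by simp
    then show ?thesis using eq qq_pow_inj by (simp del: power_Suc)
  qed
  then show False using T \<nu>0 b by simp
qed

lemma even_generator:
  assumes "eps (u 0) = 0" "S \<noteq> {\<lambda>p. 0}"
  shows "unit_at (\<lambda>i. if i = u 0 then l else 0, \<lambda>i. if i = u 0 then m else 0) \<in> S"
proof -
  obtain v \<nu> where ex: "extremal v \<nu>" using extremal_exists[OF assms(2)] .
  then have v: "v \<in> S" "v \<noteq> (\<lambda>p. 0)" "homog \<nu> v" by (auto simp: extremal_def)
  show ?thesis
  proof (rule unit_in_S[OF v(1,2)])
    fix P R assume PR: "D v P R \<noteq> 0"
    have B: "(P, R) \<in> B" using PR D_off[OF v(1)] by blast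
    have 0: "P (u j) = 0 \<and> R (u j) = 0" if "1 \<le> j" "j < n" for j
      using D_homog[OF v(3) PR, of "u j"] extremal_even[OF ex assms(1) that] by simp
    have s: "P (u 0) = l" "R (u 0) = m"
      using sum_TBasis[OF B] sum_from_0[of "\<lambda>i. P (u i)"] sum_from_0[of "\<lambda>i. R (u i)"] 0 by auto
    have "P i = (if i = u 0 then l else 0) \<and> R i = (if i = u 0 then m else 0)" for i
    proof (cases "i \<in> {1..n}")
      case True
      then have "i \<in> u ` {..<n}" using u_bij by (simp add: bij_betw_def)
      then obtain j where j: "j < n" "i = u j" by blast
      show ?thesis
      proof (cases "j = 0")
        case False
        then show ?thesis using j 0[of j] u_eq[of j 0] by auto
      qed (use j s in auto)
    next
      case False
      then have "i \<noteq> u 0" using u_range[of 0] n2 by auto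
      then show ?thesis using B False by (auto simp: TBasis_def Wbasis_iff)
    qed
    then show "P = (\<lambda>i. if i = u 0 then l else 0) \<and> R = (\<lambda>i. if i = u 0 then m else 0)" by blast
  qed
qed

section \<open>Circles with odd sites only\<close>

text \<open>Packing makes \<open>p\<close> the initial segment of length \<open>l\<close>, and
  exchange moves allow \<open>r\<close> to jump from 0 to 1 only at position \<open>l\<close>. Such
  a jump yields a weight with values 2, then 1, then 0, to which \<open>extremal_ratio\<close>
  applies.\<close>

lemma extremal_odd:
  assumes ex: "extremal v \<nu>" and odd: "\<And>j. j < n \<Longrightarrow> eps (u j) = 1"
  obtains p r where "D v p r \<noteq> 0" "\<And>j. j < n \<Longrightarrow> p (u j) = (if j < l then 1 else 0)"
    "\<And>j. j < n \<Longrightarrow> r (u j) = (if j < m then 1 else 0)"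
proof -
  have v: "v \<in> S" "homog \<nu> v" using ex by (auto simp: extremal_def)
  obtain p r where pr: "D v p r \<noteq> 0"
    and pp: "\<And>j. Suc j < n \<Longrightarrow> p (u (Suc j)) \<ge> 1 \<Longrightarrow> eps (u j) = 1 \<and> p (u j) = 1"
    using extremal_packed_fst[OF ex] by blast
  have B: "(p, r) \<in> B" using pr D_off[OF v(1)] by blast
  have w: "p i + r i = \<nu> i" for i using D_homog[OF v(2) pr] .
  have le1: "p (u j) \<le> 1" "r (u j) \<le> 1" if "j < n" for j using TBasis_odd[OF B u_range] odd that by auto
  have p: "p (u j) = (if j < l then 1 else 0)" if "j < n" for j
    by (rule staircase[where f = "\<lambda>j. p (u j)", OF _ _ sum_TBasis(1)[OF B] that]) (use le1 pp in auto)
  have ascent: "Suc j = l" if j: "Suc j < n" "r (u (Suc j)) = 1" "r (u j) = 0" for j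
  proof -
    note mv = extremal_move_snd[OF ex j(1) pr]
    have "p (u j) \<ge> 1" "D v (shift p (u (Suc j)) (u j)) (shift r (u j) (u (Suc j))) \<noteq> 0"
      using mv j by auto
    moreover from this(2) have "(shift p (u (Suc j)) (u j), shift r (u j) (u (Suc j))) \<in> B"
      using D_off[OF v(1)] by blast
    then have "shift p (u (Suc j)) (u j) (u (Suc j)) \<le> 1"
      using TBasis_odd(1)[OF _ u_range[OF j(1)]] odd[OF j(1)] by blast
    then have "p (u (Suc j)) = 0" using u_eq[of "Suc j" j] j(1) by (simp add: shift_same)
    ultimately show ?thesis using p[of j] p[of "Suc j"] j(1) by (auto split: if_splits)
  qed
  show ?thesis
  proof (cases "\<exists>j. Suc j < n \<and> r (u (Suc j)) = 1 \<and> r (u j) = 0")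
    case False
    have "r (u j) \<ge> 1" if "Suc j < n" "r (u (Suc j)) \<ge> 1" for j
    proof (rule ccontr)
      assume "\<not> r (u j) \<ge> 1"
      then have "r (u j) = 0" by simp
      moreover have "r (u (Suc j)) = 1" using le1(2)[OF that(1)] that(2) by simp
      ultimately show False using False that(1) by blast
    qed
    then have "r (u j) = (if j < m then 1 else 0)" if "j < n" for j
      by (intro staircase[where f = "\<lambda>j. r (u j)", OF _ _ sum_TBasis(2)[OF B] that]) (use le1 in auto)
    then show ?thesis using that pr p by blast
  next
    case True
    then obtain i where i: "Suc i < n" "r (u (Suc i)) = 1" "r (u i) = 0" by blast
    then have il: "Suc i = l" by (rule ascent)
    \<comment> \<open>\<open>z\<close> is the first gap of \<open>r\<close> and \<open>b\<close>
      below its last box. Since \<open>p\<close> fills exactly the sites before \<open>l\<close>, it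
      fills the gap of \<open>r\<close>, and every site from \<open>z\<close> to \<open>b\<close>
      carries one box.\<close>
    define z where "z = (LEAST j. r (u j) = 0)"
    have z: "r (u z) = 0" "z \<le> i" unfolding z_def using i(3) by (auto intro: LeastI Least_le)
    have zl: "r (u j) = 1" if "j < z" for j
    proof -
      have "r (u j) \<noteq> 0" using not_less_Least[of j "\<lambda>j. r (u j) = 0"] that by (simp add: z_def)
      then show ?thesis using le1(2)[of j] that z(2) i(1) by simp
    qed
    define J where "J = {j. j < n \<and> r (u j) = 1}"
    define b where "b = Max J"
    have J: "finite J" "Suc i \<in> J" using i by (auto simp: J_def)
    have "b \<in> J" unfolding b_def by (rule Max_in) (use J in auto)
    then have b: "b < n" "r (u b) = 1" by (simp_all add: J_def)
    have ib: "Suc i \<le> b" unfolding b_def by (rule Max_ge[OF J])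
    have after: "r (u j) = 0" if "b < j" "j < n" for j
    proof (rule ccontr)
      assume "r (u j) \<noteq> 0"
      then have "j \<in> J" using that le1(2)[of j] by (simp add: J_def)
      then have "j \<le> b" unfolding b_def by (rule Max_ge[OF J(1)])
      then show False using that by simp
    qed
    have low: "r (u j) = 0" if "z \<le> j" "j \<le> i" for j
      using that
    proof (induction j rule: dec_induct)
      case (step j)
      then have j: "Suc j < n" "r (u j) = 0" "Suc j \<noteq> l" using i(1) il by auto
      then have "r (u (Suc j)) \<noteq> 1" using ascent j by blast
      then show ?case using le1(2)[OF j(1)] by simp
    qed (rule z(1))
    have high: "r (u j) = 1" if "Suc i \<le> j" "j \<le> b" for j
      using that(2,1)
    proof (induction j rule: inc_induct)
      case (step j)
      then have j: "Suc j < n" "r (u (Suc j)) = 1" "Suc j \<noteq> l" using b(1) il by auto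
      then have "r (u j) \<noteq> 0" using ascent j by blast
      then show ?case using le1(2)[of j] j(1) by simp
    qed (rule b(2))
    have mid: "\<nu> (u j) = 1" if "z \<le> j" "j \<le> b" for j
      using w[of "u j"] p[of j] low[of j] high[of j] that b il by (cases "j \<le> i") auto
    have "qq ^ (b - z - 1) * Q (u b) ^ (\<nu> (u b) - 1) = Q (u z) ^ (\<nu> (u z) + 1)"
    proof (rule extremal_ratio[OF ex _ _ _ _ _ _ pr])
      show "z < b" "b < n" "\<nu> (u b) \<ge> 1" using z ib b mid[of b] by auto
      show "\<nu> (u j) = 0" if "b < j" "j < n" for j
        using w[of "u j"] p[of j] after[of j] that ib il by simp
      show "\<nu> (u j) = 1 \<and> eps (u j) = 1" if "z < j" "j < b" for j using mid odd that b by simp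
      show "\<nu> (u j) = 2 \<and> eps (u j) = 1" if "j < z" for j
        using w[of "u j"] p[of j] zl[of j] odd[of j] that z(2) i(1) il by simp
    qed (use b z in auto)
    moreover have "\<nu> (u b) = 1" "\<nu> (u z) = 1" using mid ib z(2) by auto
    moreover have "Q (u z) = - inverse qq" using odd[of z] z(2) i(1) by (simp add: qj_def)
    ultimately have "qq ^ (b - z - 1) = inverse qq ^ 2" by (simp add: power2_eq_square)
    then have "qq ^ (b - z - 1) * qq ^ 2 = 1" by (simp add: power_inverse)
    then have "qq ^ (b - z - 1 + 2) = qq ^ 0" by (simp only: power_add power_0)
    then show ?thesis unfolding qq_pow_inj by simp
  qed
qed

lemma pointwise_le_eq:
  assumes "(\<Sum>j<n. f j) = (\<Sum>j<n. g j :: nat)" "\<And>j. j < n \<Longrightarrow> f j \<le> g j" "j < n"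
  shows "f j = g j"
proof (rule ccontr)
  assume "f j \<noteq> g j"
  then have "(\<Sum>j<n. f j) < (\<Sum>j<n. g j)"
    using assms(2,3) by (intro sum_strict_mono_ex1) (auto intro!: bexI[of _ j] le_neq_implies_less)
  then show False using assms(1) by simp
qed

text \<open>One of the two initial segments contains the other. Its weight space is one-dimensional:
  a site of weight 2 is filled in both factors, which uses up all boxes of the shorter factor and
  thereby fixes the longer one.\<close>

lemma odd_generator:
  assumes odd: "\<And>j. j < n \<Longrightarrow> eps (u j) = 1" and "S \<noteq> {\<lambda>p. 0}"
  shows "unit_at (\<lambda>i. if i \<in> u ` {..<min l n} then 1 else 0,
    \<lambda>i. if i \<in> u ` {..<min m n} then 1 else 0) \<in> S"
proof -
  obtain v \<nu> where ex: "extremal v \<nu>" using extremal_exists[OF assms(2)] .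
  then have v: "v \<in> S" "v \<noteq> (\<lambda>p. 0)" "homog \<nu> v" by (auto simp: extremal_def)
  obtain p r where pr: "D v p r \<noteq> 0" and p: "\<And>j. j < n \<Longrightarrow> p (u j) = (if j < l then 1 else 0)"
    and r: "\<And>j. j < n \<Longrightarrow> r (u j) = (if j < m then 1 else 0)"
    using extremal_odd[OF ex odd] by blast
  have B: "(p, r) \<in> B" using pr D_off[OF v(1)] by blast
  have pos: "i \<in> u ` {..<min k n} \<longleftrightarrow> (\<exists>j<n. i = u j \<and> j < k)" for i k by auto
  show ?thesis
  proof (rule unit_in_S[OF v(1,2)])
    fix P R assume PR: "D v P R \<noteq> 0"
    have B': "(P, R) \<in> B" using PR D_off[OF v(1)] by blast
    have w: "P i + R i = p i + r i" for i using D_homog[OF v(3)] PR pr by simp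
    have le1: "P (u j) \<le> 1" "R (u j) \<le> 1" if "j < n" for j
      using TBasis_odd[OF B' u_range] odd that by auto
    have "P (u j) = p (u j) \<and> R (u j) = r (u j)" if "j < n" for j
    proof (cases "l \<le> m")
      case True
      have "p (u i) \<le> P (u i)" if "i < n" for i
        using w[of "u i"] p[OF that] r[OF that] le1[OF that] True by (cases "i < l") auto
      then have "p (u j) = P (u j)"
        by (rule pointwise_le_eq[where f = "\<lambda>j. p (u j)" and g = "\<lambda>j. P (u j)", rotated])
          (use that sum_TBasis(1)[OF B] sum_TBasis(1)[OF B'] in auto)
      then show ?thesis using w[of "u j"] by simp
    next
      case False
      have "r (u i) \<le> R (u i)" if "i < n" for i
        using w[of "u i"] p[OF that] r[OF that] le1[OF that] False by (cases "i < m") auto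
      then have "r (u j) = R (u j)"
        by (rule pointwise_le_eq[where f = "\<lambda>j. r (u j)" and g = "\<lambda>j. R (u j)", rotated])
          (use that sum_TBasis(2)[OF B] sum_TBasis(2)[OF B'] in auto)
      then show ?thesis using w[of "u j"] by simp
    qed
    then have Pp: "P (u j) = (if j < l then 1 else 0)" "R (u j) = (if j < m then 1 else 0)" if "j < n" for j
      using p r that by auto
    have "P i = (if i \<in> u ` {..<min l n} then 1 else 0) \<and> R i = (if i \<in> u ` {..<min m n} then 1 else 0)" for i
    proof (cases "i \<in> {1..n}")
      case True
      then have "i \<in> u ` {..<n}" using u_bij by (simp add: bij_betw_def)
      then obtain j where j: "j < n" "i = u j" by blast
      then show ?thesis using Pp[OF j(1)] u_eq unfolding pos by auto
    next
      case False
      then have "i \<noteq> u j" if "j < n" for j using u_range[OF that] by auto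
      then show ?thesis using B' False unfolding pos by (auto simp: TBasis_def Wbasis_iff)
    qed
    then show "P = (\<lambda>i. if i \<in> u ` {..<min l n} then 1 else 0)
      \<and> R = (\<lambda>i. if i \<in> u ` {..<min m n} then 1 else 0)" by blast
  qed
qed

end

subsection \<open>Orthogonal complements\<close>

text \<open>A proper subspace of a finite coordinate space has a nonzero annihilator for the
  standard pairing. The induction eliminates one coordinate \<open>b\<close>, unless all of
  \<open>S\<close> vanishes there and the unit vector at \<open>b\<close> already works.\<close>

lemma finite_annihilator:
  fixes S :: "('a \<Rightarrow> 'b :: field) set"
  assumes "finite B"
    and "\<And>v p. v \<in> S \<Longrightarrow> p \<notin> B \<Longrightarrow> v p = 0"
    and "\<And>u v. u \<in> S \<Longrightarrow> v \<in> S \<Longrightarrow> (\<lambda>p. u p + v p) \<in> S"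
    and "\<And>c v. v \<in> S \<Longrightarrow> (\<lambda>p. c * v p) \<in> S"
    and "\<And>p. p \<notin> B \<Longrightarrow> x p = 0" "x \<notin> S" "(\<lambda>p. 0) \<in> S"
  shows "\<exists>w. w \<noteq> (\<lambda>p. 0) \<and> (\<forall>p. p \<notin> B \<longrightarrow> w p = 0) \<and> (\<forall>v\<in>S. (\<Sum>p\<in>B. v p * w p) = 0)"
  using assms
proof (induction B arbitrary: S x rule: finite_induct)
  case empty
  then have "x = (\<lambda>p. 0)" by auto
  then show ?case using empty by simp
next
  case (insert b B)
  note off = insert.prems(1) and add = insert.prems(2) and scale = insert.prems(3)
    and x = insert.prems(4,5) and zero = insert.prems(6)
  show ?case
  proof (cases "\<forall>v\<in>S. v b = 0")
    case True
    let ?w = "\<lambda>p. if p = b then 1 else 0 :: 'b"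
    have "(\<Sum>p\<in>insert b B. v p * ?w p) = 0" if "v \<in> S" for v
      using True that by (intro sum.neutral) auto
    moreover have "?w \<noteq> (\<lambda>p. 0)" by (metis zero_neq_one)
    ultimately show ?thesis by (intro exI[of _ ?w]) auto
  next
    case False
    then obtain s0 where s0: "s0 \<in> S" "s0 b \<noteq> 0" by blast
    define s where "s = (\<lambda>p. inverse (s0 b) * s0 p)"
    have s: "s \<in> S" "s b = 1" using scale s0 by (auto simp: s_def)
    define S0 where "S0 = {v \<in> S. v b = 0}"
    have red: "(\<lambda>p. v p + - v b * s p) \<in> S0" if "v \<in> S" for v
      unfolding S0_def mem_Collect_eq using add[OF that scale[OF s(1), of "- v b"]] s(2) by (intro conjI) simp_all
    define y where "y = (\<lambda>p. x p + - x b * s p)"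
    have "y \<notin> S0"
    proof
      assume "y \<in> S0"
      then have "(\<lambda>p. y p + x b * s p) \<in> S" using add scale s by (auto simp: S0_def)
      moreover have "(\<lambda>p. y p + x b * s p) = x" by (auto simp: y_def)
      ultimately show False using x by simp
    qed
    moreover have "y p = 0" if "p \<notin> B" for p
    proof (cases "p = b")
      case True
      then show ?thesis using s(2) by (simp add: y_def)
    next
      case False
      then have "p \<notin> insert b B" using that by simp
      then show ?thesis using x(1) off[OF s(1)] by (simp add: y_def)
    qed
    moreover have "v p = 0" if "v \<in> S0" "p \<notin> B" for v p
    proof (cases "p = b")
      case True
      then show ?thesis using that by (simp add: S0_def)
    next
      case False
      then have "p \<notin> insert b B" "v \<in> S" using that by (simp_all add: S0_def)
      then show ?thesis using off by blast
    qed
    moreover have "(\<lambda>p. u p + v p) \<in> S0" if "u \<in> S0" "v \<in> S0" for u v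
      using that add by (simp add: S0_def)
    moreover have "(\<lambda>p. c * v p) \<in> S0" if "v \<in> S0" for c v
      using that scale by (simp add: S0_def)
    moreover have "(\<lambda>p. 0) \<in> S0" using zero by (simp add: S0_def)
    ultimately have "\<exists>w. w \<noteq> (\<lambda>p. 0) \<and> (\<forall>p. p \<notin> B \<longrightarrow> w p = 0) \<and> (\<forall>v\<in>S0. (\<Sum>p\<in>B. v p * w p) = 0)"
      by (intro insert.IH[of S0 y])
    then obtain w0 where w0: "w0 \<noteq> (\<lambda>p. 0)" "\<And>p. p \<notin> B \<Longrightarrow> w0 p = 0"
      "\<And>v. v \<in> S0 \<Longrightarrow> (\<Sum>p\<in>B. v p * w0 p) = 0" by blast
    \<comment> \<open>The entry at \<open>b\<close> is chosen to make \<open>w\<close> orthogonal to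
      \<open>s\<close>, which together with \<open>S0\<close> spans \<open>S\<close>.\<close>
    define w where "w = w0(b := - (\<Sum>p\<in>B. s p * w0 p))"
    have "(\<Sum>p\<in>insert b B. v p * w p) = 0" if v: "v \<in> S" for v
    proof -
      have "(\<Sum>p\<in>B. v p * w p) = (\<Sum>p\<in>B. v p * w0 p)"
        by (rule sum.cong) (use insert.hyps in \<open>auto simp: w_def\<close>)
      moreover have "(\<Sum>p\<in>B. (v p + - v b * s p) * w0 p) = 0" by (rule w0(3)[OF red[OF v]])
      then have "(\<Sum>p\<in>B. v p * w0 p) = v b * (\<Sum>p\<in>B. s p * w0 p)"
        by (simp add: algebra_simps sum.distrib sum_subtractf sum_distrib_left)
      ultimately show ?thesis using insert.hyps by (simp add: w_def)
    qed
    moreover have "w \<noteq> (\<lambda>p. 0)"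
    proof -
      obtain p where p: "w0 p \<noteq> 0" using w0(1) by blast
      then have "p \<noteq> b" using w0(2) insert.hyps by blast
      then show ?thesis using p by (auto simp: w_def fun_eq_iff)
    qed
    moreover have "w p = 0" if "p \<notin> insert b B" for p using that w0(2) by (auto simp: w_def)
    ultimately show ?thesis by blast
  qed
qed

definition form :: "nat \<Rightarrow> idx2 set \<Rightarrow> (idx2 \<Rightarrow> K) \<Rightarrow> (idx2 \<Rightarrow> K) \<Rightarrow> K" where
  "form n B v w = (\<Sum>p\<in>B. nrm n (fst p) * nrm n (snd p) * v p * w p)"

lemma form_act_right:
  assumes "finite B"
  shows "form n B v (act B C w) = (\<Sum>r\<in>B. w r * (\<Sum>p\<in>B. nrm n (fst p) * nrm n (snd p) * C p r * v p))"
proof -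
  have "form n B v (act B C w) = (\<Sum>p\<in>B. \<Sum>r\<in>B. w r * (nrm n (fst p) * nrm n (snd p) * C p r * v p))"
    unfolding form_def by (rule sum.cong) (auto simp: act_def sum_distrib_left ac_simps)
  also have "\<dots> = (\<Sum>r\<in>B. \<Sum>p\<in>B. w r * (nrm n (fst p) * nrm n (snd p) * C p r * v p))"
    by (rule sum.swap)
  finally show ?thesis by (simp add: sum_distrib_left)
qed

text \<open>For \<open>t\<close> the successor of \<open>s\<close> this is the eigenvalue of the
  inverse of \<open>k_s\<close> on the tensor product; exchanging \<open>s\<close> and
  \<open>t\<close> gives that of \<open>k_s\<close>.\<close>

definition k_inv_ev :: "(nat \<Rightarrow> nat) \<Rightarrow> nat \<Rightarrow> nat \<Rightarrow> idx2 \<Rightarrow> K" where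
  "k_inv_ev eps s t p = (qj eps t ^ (fst p t + snd p t)) / qj eps s ^ (fst p s + snd p s)"

lemma TE_adjoint:
  assumes "n \<ge> 2" "s \<in> {1..n}" "\<forall>i\<in>{1..n}. eps i \<in> {0, 1}"
    and pr: "p \<in> TBasis n eps l m" "r \<in> TBasis n eps l m" and t: "t = cyc_succ n s"
  shows "nrm n (fst p) * nrm n (snd p) * TE n eps 1 1 (s mod n) p r
    = qj eps s * k_inv_ev eps s t p * (nrm n (fst r) * nrm n (snd r) * TF n eps 1 1 (s mod n) r p)"
proof -
  have st: "s \<in> {1..n}" "t \<in> {1..n}" "s \<noteq> t"
    using assms cyc_succ_range[of n s] cyc_succ_neq[of n s] by auto
  have 1: "nrm n (fst p) * move_coeff n eps s t (fst p) (fst r)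
    = qj eps s * (qj eps t ^ fst p t / qj eps s ^ fst p s) * (nrm n (fst r) * move_coeff n eps t s (fst r) (fst p))"
    using pr st assms(3) by (intro move_coeff_adjoint) (auto simp: TBasis_def)
  have 2: "nrm n (snd p) * move_coeff n eps s t (snd p) (snd r)
    = qj eps s * (qj eps t ^ snd p t / qj eps s ^ snd p s) * (nrm n (snd r) * move_coeff n eps t s (snd r) (snd p))"
    using pr st assms(3) by (intro move_coeff_adjoint) (auto simp: TBasis_def)
  have k: "k_ev n eps (s mod n) P = qj eps s ^ P s / qj eps t ^ P t" for P
    using k_ev_eq[OF st(1)] t by simp
  have "nrm n (fst p) * nrm n (snd p) * TE n eps 1 1 (s mod n) p r
    = (nrm n (fst p) * move_coeff n eps s t (fst p) (fst r)) * (if snd p = snd r then nrm n (snd p) else 0)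
      + (if fst p = fst r then nrm n (fst p) * inverse (k_ev n eps (s mod n) (fst p)) else 0)
        * (nrm n (snd p) * move_coeff n eps s t (snd p) (snd r))"
    using st t by (simp add: TE_def Ecoef_move_coeff algebra_simps)
  also have "\<dots> = qj eps s * k_inv_ev eps s t p * (nrm n (fst r) * nrm n (snd r) * TF n eps 1 1 (s mod n) r p)"
    unfolding 1 2 using st t by (auto simp: TF_def Fcoef_move_coeff k k_inv_ev_def power_add field_simps)
  finally show ?thesis .
qed

text \<open>Every generator has an adjoint that preserves \<open>S\<close>: the omegas are
  self-adjoint, \<open>e_s\<close> has adjoint \<open>q_s f_s\<close> times the inverse of
  \<open>k_s\<close>, and \<open>f_s\<close> has adjoint \<open>k_s e_s\<close> divided by
  \<open>q_s\<close>.\<close>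

lemma (in tensor_submodule) complement_submodule:
  "is_submodule B (generators n eps 1 1) {w \<in> vspace B. \<forall>v\<in>S. form n B v w = 0}"
  (is "is_submodule B _ ?R")
proof -
  have fin: "finite B" by simp
  have act_vspace: "act B C w \<in> vspace B" for C w by (simp add: vspace_def act_def)
  have closed: "act B C w \<in> ?R" if w: "w \<in> ?R" and "\<And>v. v \<in> S \<Longrightarrow> \<exists>x\<in>S. form n B v (act B C w) = form n B x w" for C w
    using that act_vspace by auto
  have k_inv_S: "(\<lambda>p. k_inv_ev eps s t p * v p) \<in> S" if "v \<in> S" "s \<in> {1..n}" "t \<in> {1..n}" for s t v
  proof -
    have "act B (TOmegaInv eps s) (act B (TOmega eps t) v) \<in> S" using that S_TOmega S_TOmegaInv by blast
    moreover have "act B (TOmegaInv eps s) (act B (TOmega eps t) v) = (\<lambda>p. k_inv_ev eps s t p * v p)"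
      using act_TOmegaInv[OF S_vspace[OF S_TOmega[OF that(1,3)]] fin] act_TOmega[OF S_vspace[OF that(1)] fin]
      by (auto simp: k_inv_ev_def divide_inverse ac_simps)
    ultimately show ?thesis by simp
  qed
  have "act B C w \<in> ?R" if C: "C \<in> generators n eps 1 1" and w: "w \<in> ?R" for C w
  proof -
    have wv: "w \<in> vspace B" using w by simp
    consider j where "j \<in> {1..n}" "C = TOmega eps j" | j where "j \<in> {1..n}" "C = TOmegaInv eps j"
      | i where "i < n" "C = TE n eps 1 1 i" | i where "i < n" "C = TF n eps 1 1 i"
      using C by (auto simp: generators_def)
    then show ?thesis
    proof cases
      case (1 j)
      have "form n B v (act B C w) = form n B (act B C v) w" if "v \<in> S" for v
        unfolding form_def 1(2) act_TOmega[OF wv fin] act_TOmega[OF S_vspace[OF that] fin]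
        by (simp add: ac_simps)
      then show ?thesis using S_TOmega 1 by (intro closed[OF w]) blast
    next
      case (2 j)
      have "form n B v (act B C w) = form n B (act B C v) w" if "v \<in> S" for v
        unfolding form_def 2(2) act_TOmegaInv[OF wv fin] act_TOmegaInv[OF S_vspace[OF that] fin]
        by (simp add: ac_simps)
      then show ?thesis using S_TOmegaInv 2 by (intro closed[OF w]) blast
    next
      case (3 i)
      define s where "s = ix n i"
      have s: "s \<in> {1..n}" "s mod n = i" using 3 n2 by (auto simp: s_def ix_def Suc_le_eq)
      define t where "t = cyc_succ n s"
      have t: "t \<in> {1..n}" using cyc_succ_range n2 by (simp add: t_def)
      have "\<exists>x\<in>S. form n B v (act B C w) = form n B x w" if v: "v \<in> S" for v
      proof -
        define v' where "v' = (\<lambda>p. k_inv_ev eps s t p * v p)"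
        have v': "v' \<in> S" unfolding v'_def by (rule k_inv_S[OF v s(1) t])
        define x where "x = (\<lambda>p. Q s * act B (TF n eps 1 1 (s mod n)) v' p)"
        have "x \<in> S" unfolding x_def by (intro S_scale S_TF v' s)
        moreover have "form n B v (act B C w) = form n B x w"
        proof -
          have "(\<Sum>p\<in>B. nrm n (fst p) * nrm n (snd p) * C p r * v p)
            = nrm n (fst r) * nrm n (snd r) * x r" if r: "r \<in> B" for r
          proof -
            have "(\<Sum>p\<in>B. nrm n (fst p) * nrm n (snd p) * C p r * v p)
              = (\<Sum>p\<in>B. nrm n (fst r) * nrm n (snd r) * (Q s * (TF n eps 1 1 (s mod n) r p * v' p)))"
            proof (rule sum.cong)
              fix p assume p: "p \<in> B"
              show "nrm n (fst p) * nrm n (snd p) * C p r * v p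
                = nrm n (fst r) * nrm n (snd r) * (Q s * (TF n eps 1 1 (s mod n) r p * v' p))"
                using TE_adjoint[OF n2 s(1) eps01 p r t_def] 3(2) s(2) by (simp add: v'_def ac_simps)
            qed simp
            also have "\<dots> = nrm n (fst r) * nrm n (snd r) * x r"
              using r by (simp add: x_def act_def sum_distrib_left)
            finally show ?thesis .
          qed
          then have "form n B v (act B C w) = (\<Sum>r\<in>B. w r * (nrm n (fst r) * nrm n (snd r) * x r))"
            unfolding form_act_right[OF fin] by (intro sum.cong) simp_all
          then show ?thesis by (simp add: form_def ac_simps)
        qed
        ultimately show ?thesis by blast
      qed
      then show ?thesis by (rule closed[OF w])
    next
      case (4 i)
      define s where "s = ix n i"
      have s: "s \<in> {1..n}" "s mod n = i" using 4 n2 by (auto simp: s_def ix_def Suc_le_eq)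
      define t where "t = cyc_succ n s"
      have t: "t \<in> {1..n}" using cyc_succ_range n2 by (simp add: t_def)
      have "\<exists>x\<in>S. form n B v (act B C w) = form n B x w" if v: "v \<in> S" for v
      proof -
        define y where "y = act B (TE n eps 1 1 (s mod n)) v"
        have y: "y \<in> S" unfolding y_def by (rule S_TE[OF v s(1)])
        define x where "x = (\<lambda>p. inverse (Q s) * (k_inv_ev eps t s p * y p))"
        have "x \<in> S" unfolding x_def by (intro S_scale k_inv_S y s t)
        moreover have "form n B v (act B C w) = form n B x w"
        proof -
          have "(\<Sum>r\<in>B. nrm n (fst r) * nrm n (snd r) * C r p * v r)
            = nrm n (fst p) * nrm n (snd p) * x p" if p: "p \<in> B" for p
          proof -
            have "(\<Sum>r\<in>B. nrm n (fst r) * nrm n (snd r) * C r p * v r)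
              = (\<Sum>r\<in>B. nrm n (fst p) * nrm n (snd p) * (inverse (Q s) * (k_inv_ev eps t s p * (TE n eps 1 1 (s mod n) p r * v r))))"
            proof (rule sum.cong)
              fix r assume r: "r \<in> B"
              have inv: "k_inv_ev eps t s p * k_inv_ev eps s t p = 1" by (simp add: k_inv_ev_def)
              have "nrm n (fst p) * nrm n (snd p) * (inverse (Q s) * (k_inv_ev eps t s p * (TE n eps 1 1 (s mod n) p r * v r)))
                = inverse (Q s) * k_inv_ev eps t s p * v r * (nrm n (fst p) * nrm n (snd p) * TE n eps 1 1 (s mod n) p r)"
                by (simp add: ac_simps)
              also have "\<dots> = (inverse (Q s) * Q s) * (k_inv_ev eps t s p * k_inv_ev eps s t p)
                  * (nrm n (fst r) * nrm n (snd r) * C r p * v r)"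
                unfolding TE_adjoint[OF n2 s(1) eps01 p r t_def] using 4(2) s(2) by (simp only: ac_simps)
              also have "\<dots> = nrm n (fst r) * nrm n (snd r) * C r p * v r" unfolding inv by simp
              finally show "nrm n (fst r) * nrm n (snd r) * C r p * v r
                = nrm n (fst p) * nrm n (snd p) * (inverse (Q s) * (k_inv_ev eps t s p * (TE n eps 1 1 (s mod n) p r * v r)))" ..
            qed simp
            also have "\<dots> = nrm n (fst p) * nrm n (snd p) * x p"
              using p by (simp add: x_def y_def act_def sum_distrib_left)
            finally show ?thesis .
          qed
          then have "form n B v (act B C w) = (\<Sum>r\<in>B. w r * (nrm n (fst r) * nrm n (snd r) * x r))"
            unfolding form_act_right[OF fin] by (intro sum.cong) simp_all
          then show ?thesis by (simp add: form_def ac_simps)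
        qed
        ultimately show ?thesis by blast
      qed
      then show ?thesis by (rule closed[OF w])
    qed
  qed
  moreover have "form n B v (\<lambda>p. 0) = 0" for v by (simp add: form_def)
  moreover have "form n B v (\<lambda>p. a p + b p) = form n B v a + form n B v b" for v a b
    by (simp add: form_def algebra_simps sum.distrib)
  moreover have "form n B v (\<lambda>p. c * a p) = c * form n B v a" for v a c
    by (simp add: form_def sum_distrib_left ac_simps)
  ultimately show ?thesis unfolding is_submodule_def by (auto simp: vspace_def)
qed

section \<open>Rotating the circle and the common vector\<close>

lemma cyc_succ_ix: "cyc_succ n (ix n k) = ix n (Suc k)"
proof -
  have "ix n k mod n = k mod n" by (simp add: ix_def)
  then have "(ix n k + 1) mod n = Suc k mod n" by (metis mod_Suc_eq Suc_eq_plus1)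
  then show ?thesis by (simp add: cyc_succ_def ix_def)
qed

lemma tensor_sites_rotation:
  assumes "tensor_submodule n l m eps S"
  shows "tensor_sites n l m eps S (\<lambda>j. ix n (a + j))"
proof -
  interpret tensor_submodule n l m eps S by fact
  have ixm: "ix n i mod n = i mod n" for i by (simp add: ix_def)
  have inj: "i = j" if "i \<le> j" "j < n" "(a + i) mod n = (a + j) mod n" for i j
  proof -
    have "n dvd j - i" using mod_eq_dvd_iff_nat[of "a + i" "a + j" n] that by simp
    then show ?thesis using that by (metis diff_is_0_eq dvd_imp_le le_antisym less_imp_diff_less
          linorder_not_le nat_less_le not_gr_zero)
  qed
  have "inj_on (\<lambda>j. ix n (a + j)) {..<n}"
  proof (rule inj_onI)
    fix i j assume h: "i \<in> {..<n}" "j \<in> {..<n}" "ix n (a + i) = ix n (a + j)"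
    then have "(a + i) mod n = (a + j) mod n" using ixm by metis
    then show "i = j" using h inj[of i j] inj[of j i] by (cases "i \<le> j") auto
  qed
  moreover have "(\<lambda>j. ix n (a + j)) ` {..<n} \<subseteq> {1..n}" using ix_range n2 by auto
  ultimately have "bij_betw (\<lambda>j. ix n (a + j)) {..<n} {1..n}"
    unfolding bij_betw_def by (simp add: card_image card_subset_eq)
  then show ?thesis
  proof unfold_locales
    show "cyc_succ n (ix n (a + j)) = ix n (a + Suc j)" for j by (simp add: cyc_succ_ix)
    show "ix n (a + n) = ix n (a + 0)" by (simp add: ix_def)
  qed
qed

text \<open>The order of quantifiers matters: the starting site, and with it \<open>p\<close>,
  depends on \<open>eps\<close> alone, so the same vector lies in a submodule and in its
  complement.\<close>

lemma common_vector:
  assumes "2 \<le> n" and eps: "\<forall>i\<in>{1..n}. eps i \<in> {0, 1}"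
  obtains p where "\<And>S. is_submodule (TBasis n eps l m) (generators n eps 1 1) S \<Longrightarrow> S \<noteq> {\<lambda>p. 0}
    \<Longrightarrow> unit_at p \<in> S"
proof (cases "\<exists>a\<in>{1..n}. eps a = 0")
  case True
  then obtain a where a: "a \<in> {1..n}" "eps a = 0" by blast
  have a0: "ix n (a + 0) = a" using a by (cases "a = n") (auto simp: ix_def)
  show ?thesis
  proof (rule that)
    fix S assume S: "is_submodule (TBasis n eps l m) (generators n eps 1 1) S" "S \<noteq> {\<lambda>p. 0}"
    interpret tensor_sites n l m eps S "\<lambda>j. ix n (a + j)"
      by (rule tensor_sites_rotation) (unfold_locales; fact)
    show "unit_at (\<lambda>i. if i = a then l else 0, \<lambda>i. if i = a then m else 0) \<in> S"
      using even_generator[OF _ S(2)] a(2) unfolding a0 by simp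
  qed
next
  case False
  show ?thesis
  proof (rule that)
    fix S assume S: "is_submodule (TBasis n eps l m) (generators n eps 1 1) S" "S \<noteq> {\<lambda>p. 0}"
    interpret tensor_sites n l m eps S "\<lambda>j. ix n (1 + j)"
      by (rule tensor_sites_rotation) (unfold_locales; fact)
    have "eps (ix n (1 + j)) = 1" if "j < n" for j using u_range[OF that] False eps by blast
    from odd_generator[OF this S(2)]
    show "unit_at (\<lambda>i. if i \<in> (\<lambda>j. ix n (1 + j)) ` {..<min l n} then 1 else 0,
      \<lambda>i. if i \<in> (\<lambda>j. ix n (1 + j)) ` {..<min m n} then 1 else 0) \<in> S" .
  qed
qed

theorem theorem4p8:
  fixes n l m :: nat and eps :: "nat \<Rightarrow> nat"
  assumes "n \<ge> 4"
    and "\<forall>i\<in>{1..n}. eps i \<in> {0, 1}"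
    and "Wbasis n eps l \<noteq> {}" and "Wbasis n eps m \<noteq> {}"
  shows "irreducible_mod (TBasis n eps l m) (generators n eps 1 1)"
proof -
  let ?B = "TBasis n eps l m" and ?G = "generators n eps 1 1"
  obtain p where p: "\<And>S. is_submodule ?B ?G S \<Longrightarrow> S \<noteq> {\<lambda>p. 0} \<Longrightarrow> unit_at p \<in> S"
    using common_vector[of n eps l m] assms(1,2) by auto
  \<comment> \<open>Nonemptiness excludes the zero module, which occurs exactly when all sites are
    odd and \<open>l\<close> or \<open>m\<close> exceeds \<open>n\<close>.\<close>
  obtain p1 where "p1 \<in> ?B" using assms(3,4) by (auto simp: TBasis_def)
  then have "unit_at p1 \<in> vspace ?B" by (auto simp: vspace_def unit_at_def)
  moreover have "unit_at p1 p1 \<noteq> 0" by (simp add: unit_at_def)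
  ultimately have "vspace ?B \<noteq> {\<lambda>p. 0}" by force
  moreover have "S = vspace ?B" if S: "is_submodule ?B ?G S" "S \<noteq> {\<lambda>p. 0}" for S
  proof (rule ccontr)
    assume "S \<noteq> vspace ?B"
    interpret tensor_submodule n l m eps S by unfold_locales (use assms S in auto)
    obtain x where x: "x \<in> vspace ?B" "x \<notin> S" using S_vspace \<open>S \<noteq> vspace ?B\<close> by blast
    have "\<exists>w. w \<noteq> (\<lambda>p. 0) \<and> (\<forall>p. p \<notin> ?B \<longrightarrow> w p = 0) \<and> (\<forall>v\<in>S. (\<Sum>p\<in>?B. v p * w p) = 0)"
      using x S_off S_add S_scale S_zero by (intro finite_annihilator) (auto simp: vspace_def)
    then obtain w where w: "w \<noteq> (\<lambda>p. 0)" "\<And>p. p \<notin> ?B \<Longrightarrow> w p = 0" "\<And>v. v \<in> S \<Longrightarrow> (\<Sum>p\<in>?B. v p * w p) = 0"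
      by blast
    define R where "R = {w \<in> vspace ?B. \<forall>v\<in>S. form n ?B v w = 0}"
    \<comment> \<open>Dividing by the norms turns an annihilator for the standard pairing into a
      vector orthogonal for \<open>form\<close>.\<close>
    define w' where "w' = (\<lambda>p. w p / (nrm n (fst p) * nrm n (snd p)))"
    have "form n ?B v w' = (\<Sum>p\<in>?B. v p * w p)" for v
      unfolding form_def w'_def by (rule sum.cong) simp_all
    then have "w' \<in> R" using w(2,3) by (simp add: R_def vspace_def w'_def)
    moreover have "w' \<noteq> (\<lambda>p. 0)" using w(1) by (auto simp: w'_def fun_eq_iff)
    ultimately have "unit_at p \<in> R" using p complement_submodule by (auto simp: R_def)
    moreover have pS: "unit_at p \<in> S" using p S by blast
    ultimately have "form n ?B (unit_at p) (unit_at p) = 0" by (simp add: R_def)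
    moreover have "p \<in> ?B"
      using S_off[OF pS, of p] by (auto simp: unit_at_def)
    then have "form n ?B (unit_at p) (unit_at p) = nrm n (fst p) * nrm n (snd p)"
      unfolding form_def unit_at_def by (subst sum.remove[of _ p]) auto
    ultimately show False by simp
  qed
  ultimately show ?thesis unfolding irreducible_mod_def by blast
qed

end
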